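(* Let $0<\alpha\le 1$, let $(\boldsymbol{\pi},\boldsymbol{T})$ be a phase-type representation of dimension $p$, let $\boldsymbol{R}$ be a $p\times n$ matrix with nonnegative entries, and let $\boldsymbol{X}=(X_1,\dots,X_n)$ be a random vector in $\mathbb{R}_+^n$ with joint Laplace transform $$\mathbb{E}\big(e^{-\langle\boldsymbol{u},\boldsymbol{X}\rangle}\big)=\boldsymbol{\pi}\left(\boldsymbol{\Delta}(\boldsymbol{R}\boldsymbol{u}^{\alpha})-\boldsymbol{T}\right)^{-1}\boldsymbol{t},\qquad\boldsymbol{u}\in\mathbb{R}_+^n,$$ where $\boldsymbol{u}^\alpha=(u_1^\alpha,\dots,u_n^\alpha)$. Let $\boldsymbol{w}\ge\boldsymbol{0}$ be a non-zero vector in $\mathbb{R}^n$ and $\boldsymbol{w}^\alpha=(w_1^\alpha,\dots,w_n^\alpha)$. Let $E_+=\{i\in\{1,\dots,p\}:(\boldsymbol{R}\boldsymbol{w}^\alpha)_i>0\}$ and $E_0=\{i\in\{1,\dots,p\}:(\boldsymbol{R}\boldsymbol{w}^\alpha)_i=0\}$, and decompose accordingly $\boldsymbol{\pi}=(\boldsymbol{\pi}_+,\boldsymbol{\pi}_0)$ and $$\boldsymbol{T}=\begin{pmatrix}\boldsymbol{T}_{++}&\boldsymbol{T}_{+0}\\ \boldsymbol{T}_{0+}&\boldsymbol{T}_{00}\end{pmatrix}.$$ Then the distribution of $\langle\boldsymbol{X},\boldsymbol{w}\rangle$ has an atom at zero of size $$q=\boldsymbol{\pi}_0\left(\boldsymbol{e}-(-\boldsymbol{T}_{00})^{-1}\boldsymbol{T}_{0+}\boldsymbol{e}\right)$$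 and a possibly defective absolutely continuous part which is $\mathrm{MML}(\alpha,\boldsymbol{\pi}_{\boldsymbol{w}^\alpha},\boldsymbol{T}_{\boldsymbol{w}^\alpha})$, where $$\boldsymbol{\pi}_{\boldsymbol{w}^\alpha}=\boldsymbol{\pi}_++\boldsymbol{\pi}_0(-\boldsymbol{T}_{00})^{-1}\boldsymbol{T}_{0+},\qquad \boldsymbol{T}_{\boldsymbol{w}^\alpha}=\boldsymbol{\Delta}\big((\boldsymbol{R}\boldsymbol{w}^\alpha)_+\big)^{-1}\left(\boldsymbol{T}_{++}+\boldsymbol{T}_{+0}(-\boldsymbol{T}_{00})^{-1}\boldsymbol{T}_{0+}\right).$$
   Context: $\mathbb{R}_+=[0,\infty)$. A phase-type representation $(\boldsymbol{\pi},\boldsymbol{T})$ of dimension $p$ consists of a probability row vector $\boldsymbol{\pi}=(\pi_1,\dots,\pi_p)$ and a $p\times p$ sub-intensity matrix $\boldsymbol{T}$, i.e. the restriction to the transient states $1,\dots,p$ of the intensity matrix of a Markov jump process on $\{1,\dots,p,p+1\}$ in which $1,\dots,p$ are transient and $p+1$ is absorbing (off-diagonal entries nonnegative, row sums nonpositive, $\boldsymbol{T}$ invertible). Put $\boldsymbol{t}=-\boldsymbol{T}\boldsymbol{e}$. $\boldsymbol{e}$ denotes a column vector of ones of whatever dimension is required, $\boldsymbol{\Delta}(\boldsymbol{a})$ the diagonal matrix with the vector $\boldsymbol{a}$ on the diagonal, and $(\cdot)_+$ the restriction of a vector to the indices in $E_+$. Vectors multiplied by $\boldsymbol{R}$ are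 regarded as column vectors. Terms involving an empty index set are interpreted as absent (zero). A random variable has distribution $\mathrm{MML}(\alpha,\boldsymbol{\pi},\boldsymbol{T})$ (matrix Mittag-Leffler), $0<\alpha\le 1$, if its Laplace transform is $\boldsymbol{\pi}(u^\alpha\boldsymbol{I}-\boldsymbol{T})^{-1}(-\boldsymbol{T}\boldsymbol{e})$, $u\ge 0$. "Possibly defective" means that the initial vector may have total mass less than one: the absolutely continuous part of the law of $\langle\boldsymbol{X},\boldsymbol{w}\rangle$ is the absolutely continuous (sub-probability) measure on $(0,\infty)$ with Laplace transform $\boldsymbol{\pi}_{\boldsymbol{w}^\alpha}(u^\alpha\boldsymbol{I}-\boldsymbol{T}_{\boldsymbol{w}^\alpha})^{-1}\boldsymbol{t}_{\boldsymbol{w}^\alpha}$, $\boldsymbol{t}_{\boldsymbol{w}^\alpha}=-\boldsymbol{T}_{\boldsymbol{w}^\alpha}\boldsymbol{e}$, and the law is the sum of $q$ times the unit mass at $0$ and this measure. *)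

theory Defs
  imports
    "HOL-Probability.Probability"
    "Jordan_Normal_Form.DL_Submatrix"
    "Jordan_Normal_Form.Gauss_Jordan_Elimination"
begin

unbundle no vec_syntax
unbundle no inner_syntax
hide_type (open) Finite_Cartesian_Product.vec
hide_const (open) Finite_Cartesian_Product.vec Finite_Cartesian_Product.mat

text \<open>
  States and coordinates are numbered from 0. A product a A b of a row vector, a matrix and a
  column vector is written \<open>a \<bullet> (A *\<^sub>v b)\<close>, and a row vector a A is written \<open>A\<^sup>T *\<^sub>v a\<close>.
  Matrices of dimension 0 are allowed, and sums over an empty index set are 0.
\<close>

text \<open>The value is unspecified if the matrix is not invertible.\<close>

definition mat_inv :: "real Matrix.mat \<Rightarrow> real Matrix.mat" where
  "mat_inv A = the (mat_inverse A)"

definition diag_of :: "real Matrix.vec \<Rightarrow> real Matrix.mat" where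
  "diag_of a = mat_diag (dim_vec a) (\<lambda>i. a $ i)"

definition ones :: "nat \<Rightarrow> real Matrix.vec" where
  "ones k = Matrix.vec k (\<lambda>_. 1)"

text \<open>Note that \<open>0 powr \<alpha> = 0\<close>, which is the intended value for \<open>\<alpha> > 0\<close>.\<close>

definition vec_powr :: "real Matrix.vec \<Rightarrow> real \<Rightarrow> real Matrix.vec" where
  "vec_powr u \<alpha> = map_vec (\<lambda>x. x powr \<alpha>) u"

text \<open>The analogue of \<^const>\<open>submatrix\<close> for vectors.\<close>

definition subvec :: "real Matrix.vec \<Rightarrow> nat set \<Rightarrow> real Matrix.vec" where
  "subvec v I = Matrix.vec (card {i. i < dim_vec v \<and> i \<in> I}) (\<lambda>i. v $ pick I i)"

definition exit_vec :: "real Matrix.mat \<Rightarrow> real Matrix.vec" where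
  "exit_vec T = (- T) *\<^sub>v ones (dim_col T)"

definition sub_intensity_matrix :: "nat \<Rightarrow> real Matrix.mat \<Rightarrow> bool" where
  "sub_intensity_matrix p T \<longleftrightarrow>
     T \<in> carrier_mat p p \<and>
     (\<forall>i<p. \<forall>j<p. i \<noteq> j \<longrightarrow> 0 \<le> T $$ (i, j)) \<and>
     (\<forall>i<p. (\<Sum>j<p. T $$ (i, j)) \<le> 0) \<and>
     invertible_mat T"

definition phase_type_rep :: "nat \<Rightarrow> real Matrix.vec \<Rightarrow> real Matrix.mat \<Rightarrow> bool" where
  "phase_type_rep p \<pi> T \<longleftrightarrow>
     \<pi> \<in> carrier_vec p \<and> (\<forall>i<p. 0 \<le> \<pi> $ i) \<and> (\<Sum>i<p. \<pi> $ i) = 1 \<and>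
     sub_intensity_matrix p T"

definition defective_phase_type_rep :: "nat \<Rightarrow> real Matrix.vec \<Rightarrow> real Matrix.mat \<Rightarrow> bool" where
  "defective_phase_type_rep p \<pi> T \<longleftrightarrow>
     \<pi> \<in> carrier_vec p \<and> (\<forall>i<p. 0 \<le> \<pi> $ i) \<and> (\<Sum>i<p. \<pi> $ i) \<le> 1 \<and>
     sub_intensity_matrix p T"

definition mml_transform ::
    "real \<Rightarrow> real Matrix.vec \<Rightarrow> real Matrix.mat \<Rightarrow> real \<Rightarrow> real" where
  "mml_transform \<alpha> \<pi> T u =
     \<pi> \<bullet> (mat_inv (u powr \<alpha> \<cdot>\<^sub>m 1\<^sub>m (dim_row T) - T) *\<^sub>v exit_vec T)"

text \<open>
  The possibly defective matrix Mittag-Leffler law: a sub-probability measure on the nonnegative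
  half-line, given by its Laplace transform.
\<close>

definition defective_MML ::
    "real \<Rightarrow> real Matrix.vec \<Rightarrow> real Matrix.mat \<Rightarrow> real measure \<Rightarrow> bool" where
  "defective_MML \<alpha> \<pi> T \<nu> \<longleftrightarrow>
     0 < \<alpha> \<and> \<alpha> \<le> 1 \<and> defective_phase_type_rep (dim_vec \<pi>) \<pi> T \<and>
     sets \<nu> = sets borel \<and> emeasure \<nu> UNIV \<le> 1 \<and> emeasure \<nu> {..<0} = 0 \<and>
     (\<forall>u\<ge>0. (LINT x|\<nu>. exp (- (u * x))) = mml_transform \<alpha> \<pi> T u)"

end

theory Submission
  imports Defs "Jordan_Normal_Form.Determinant"
begin

text \<open>
  Let \<open>Y = \<Sum>j<n. X j * w $ j\<close> and \<open>r = R *\<^sub>v vec_powr w \<alpha>\<close>. Evaluating the joint transform along the ray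
  through \<open>w\<close> gives \<open>E (exp (- u Y)) = \<pi> (u\<^sup>\<alpha> \<Delta>(r) - T)\<^sup>-\<^sup>1 t\<close>. The states of \<open>Ez\<close>, where \<open>r\<close> vanishes,
  contribute equations that do not contain \<open>u\<close>, so they can be eliminated once and for all. This is
  block elimination in the linear system; probabilistically, it watches the jump process only while it
  is in \<open>Ep\<close>. The elimination leaves a constant, which is \<open>q\<close>, and a transform of the same shape in
  which the Schur complement, with its rows divided by the positive entries of \<open>r\<close>, plays the role of
  \<open>T\<close>; this is \<open>resolvent_reduction\<close>.

  The elimination is legitimate because the negative of a sub-intensity matrix is a nonsingular
  M-matrix: some positive vector \<open>z\<close> has \<open>- T z > 0\<close> (\<open>sub_intensity_imp_M_matrix\<close>). Restricting
  \<open>z\<close> to a block shows that principal blocks and Schur complements have the same property, and the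
  minimum principle \<open>M_matrix_minimum_principle\<close> turns it into invertibility with a nonnegative inverse.
  Hence \<open>q\<close>, \<open>\<pi>w\<close> and \<open>Tw\<close> have the right signs and \<open>Tw\<close> is again a sub-intensity matrix.

  The analytic content is that \<open>q\<close> is the whole atom at zero and that the remainder has a density. For
  large \<open>u\<close> the Neumann series of the resolvent gives an expansion
  \<open>q + (\<Sum>k. c k * u powr (- \<alpha> * (k + 1)))\<close> with geometrically bounded coefficients
  (\<open>mml_transform_expansion\<close>). Each power of \<open>u\<close> is the Laplace transform of a Gamma type density
  \<open>x powr (\<alpha> * (k + 1) - 1) / Gamma (\<alpha> * (k + 1))\<close>. Collecting the terms with \<open>c k > 0\<close> in one measure
  \<open>P\<close> and those with \<open>c k < 0\<close> in another measure \<open>N\<close>, both absolutely continuous, the law of \<open>Y\<close> plus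
  \<open>N\<close> has the same transform as \<open>q\<close> times the unit mass at zero plus \<open>P\<close>. Measures on the half-line
  with equal finite transforms for all large arguments are equal (\<open>measure_eqI_laplace\<close>), so the law has
  exactly the atom \<open>q\<close> and charges no Lebesgue null set away from
  zero.
\<close>

hide_const (open) Determinants.det

section \<open>Uniqueness of Laplace transforms\<close>

text \<open>
  By Weierstrass approximation the moments fix the integrals of continuous functions; indicators of
  left half-lines are limits of these, and left half-lines generate the Borel sets.
\<close>

lemma finite_measure_eqI_moments:
  fixes M N :: "real measure"
  assumes fin: "finite_measure M" "finite_measure N"
    and sets: "sets M = sets borel" "sets N = sets borel"
    and supp: "AE x in M. x \<in> {0..1}" "AE x in N. x \<in> {0..1}"
    and moments: "\<And>k. (LINT x|M. x ^ k) = (LINT x|N. x ^ k)"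
  shows "M = N"
proof -
  interpret M: finite_measure M by fact
  interpret N: finite_measure N by fact
  have [measurable_cong]: "sets M = sets borel" "sets N = sets borel" using sets .
  have integ: "integrable L f" if "L = M \<or> L = N" "f \<in> borel_measurable borel"
      "\<And>x. x \<in> {0..1} \<Longrightarrow> \<bar>f x\<bar> \<le> B" for L f and B :: real
  proof -
    interpret L: finite_measure L using that fin by auto
    have L: "AE x in L. x \<in> {0..1}" using that supp by auto
    have "f \<in> borel_measurable L" using that sets by (metis measurable_cong_sets)
    then show ?thesis
      by (rule L.integrable_const_bound[rotated]) (use L that in \<open>auto\<close>)
  qed
  have poly: "(LINT x|M. (\<Sum>i\<le>m. a i * x ^ i)) = (LINT x|N. (\<Sum>i\<le>m. a i * x ^ i))"
    for m :: nat and a :: "nat \<Rightarrow> real"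
  proof -
    have "integrable L (\<lambda>x. x ^ k)" if "L = M \<or> L = N" for L and k :: nat
      by (rule integ[OF that, where B = 1]) (auto simp: power_le_one)
    then show ?thesis by (simp add: Bochner_Integration.integral_sum moments)
  qed
  \<comment> \<open>The two integrals differ by at most \<open>e / K\<close> times the sum of the masses; the summand 1 in \<open>K\<close>
    keeps it positive when both measures vanish.\<close>
  have cont: "(LINT x|M. f x) = (LINT x|N. f x)" if f: "continuous_on UNIV f" "\<And>x. \<bar>f x\<bar> \<le> 1"
    for f :: "real \<Rightarrow> real"
  proof -
    have fm[measurable]: "f \<in> borel_measurable borel"
      using f(1) by (rule borel_measurable_continuous_onI)
    define K where "K = measure M (space M) + measure N (space N) + 1"
    have "K > 0" by (simp add: K_def add_nonneg_pos)
    have "\<bar>(LINT x|M. f x) - (LINT x|N. f x)\<bar> \<le> e" if "e > 0" for e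
    proof -
      obtain g where g: "real_polynomial_function g" "\<And>x. x \<in> {0..1} \<Longrightarrow> \<bar>f x - g x\<bar> < e / K"
        using Stone_Weierstrass_real_polynomial_function[of "{0..1::real}" f "e / K"] f(1) \<open>e > 0\<close> \<open>K > 0\<close>
        by (metis compact_Icc continuous_on_subset divide_pos_pos top_greatest)
      obtain a m where gm: "g = (\<lambda>x. \<Sum>i\<le>m. a i * x ^ i)"
        using g(1) real_polynomial_function_iff_sum by auto
      have [measurable]: "g \<in> borel_measurable borel" by (simp add: gm)
      have eq: "(LINT x|M. g x) = (LINT x|N. g x)" using poly by (simp add: gm)
      have b: "\<bar>g x\<bar> \<le> 1 + e / K" if "x \<in> {0..1}" for x
        using g(2)[OF that] f(2)[of x] by linarith
      have close: "\<bar>(LINT x|L. f x) - (LINT x|L. g x)\<bar> \<le> e / K * measure L (space L)" if L: "L = M \<or> L = N" for L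
      proof -
        interpret L: finite_measure L using that fin by auto
        have ae: "AE x in L. x \<in> {0..1}" using that supp by auto
        have i: "integrable L f" "integrable L g"
          by (rule integ[OF L, where B = 1] integ[OF L, where B = "1 + e / K"]; use f b in auto)+
        have "\<bar>(LINT x|L. f x) - (LINT x|L. g x)\<bar> = \<bar>LINT x|L. f x - g x\<bar>"
          using i by simp
        also have "\<dots> \<le> (LINT x|L. \<bar>f x - g x\<bar>)" using integral_abs_bound by blast
        also have "\<dots> \<le> (LINT x|L. e / K)"
        proof (rule integral_mono_AE)
          show "AE x in L. \<bar>f x - g x\<bar> \<le> e / K"
            using ae by eventually_elim (use g(2) in \<open>simp add: less_imp_le\<close>)
        qed (use i in auto)
        finally show ?thesis by (simp add: mult.commute)
      qed
      have "\<bar>(LINT x|M. f x) - (LINT x|N. f x)\<bar> \<le> e / K * (measure M (space M) + measure N (space N))"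
        using close[of M] close[of N] eq by (simp add: algebra_simps)
      also have "\<dots> \<le> e / K * K"
        using \<open>K > 0\<close> \<open>e > 0\<close> by (intro mult_left_mono) (auto simp: K_def)
      finally show ?thesis using \<open>K > 0\<close> by simp
    qed
    then show ?thesis
      by (metis abs_le_zero_iff eq_iff_diff_eq_0 field_le_epsilon add_0)
  qed
  have half: "measure M {..a} = measure N {..a}" for a
  proof -
    \<comment> \<open>The functions \<open>h n\<close> fall linearly from 1 at \<open>a\<close> to 0 at \<open>a + 1 / n\<close>.\<close>
    define h where "h = (\<lambda>(n::nat) x. max 0 (1 - real n * max 0 (x - a)))"
    have hlim: "(\<lambda>n. h n x) \<longlonglongrightarrow> indicator {..a} x" for x
    proof (cases "x \<le> a")
      case True then show ?thesis by (simp add: h_def)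
    next
      case False
      then obtain n0 :: nat where n0: "1 < real n0 * (x - a)"
        using ex_less_of_nat_mult[of "x - a" 1] by auto
      have "h n x = 0" if "n \<ge> n0" for n
      proof -
        have "real n0 * (x - a) \<le> real n * (x - a)" using that False by (intro mult_right_mono) auto
        moreover have "max 0 (x - a) = x - a" using False by simp
        ultimately have "1 - real n * max 0 (x - a) \<le> 0" using n0 by linarith
        then show ?thesis unfolding h_def by (rule max_absorb1)
      qed
      then have "eventually (\<lambda>n. h n x = indicator {..a} x) sequentially"
        using False by (auto simp: eventually_sequentially intro!: exI[of _ n0])
      then show ?thesis by (rule tendsto_eventually)
    qed
    have hc: "continuous_on UNIV (h n)" for n unfolding h_def by (intro continuous_intros)
    have hb: "\<bar>h n x\<bar> \<le> 1" for n x unfolding h_def by auto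
    have [measurable]: "h n \<in> borel_measurable borel" for n
      using hc by (rule borel_measurable_continuous_onI)
    have lim: "(\<lambda>n. LINT x|L. h n x) \<longlonglongrightarrow> (LINT x|L. indicator {..a} x)" if L: "L = M \<or> L = N" for L
    proof -
      interpret L: finite_measure L using that fin by auto
      have [measurable_cong]: "sets L = sets borel" using that sets by auto
      show ?thesis
        by (rule integral_dominated_convergence[where w = "\<lambda>_. 1"]) (use hb hlim in auto)
    qed
    have "(LINT x|M. indicator {..a} x :: real) = (LINT x|N. indicator {..a} x)"
    proof (rule LIMSEQ_unique[OF lim])
      show "(\<lambda>n. LINT x|M. h n x) \<longlonglongrightarrow> (LINT x|N. indicator {..a} x)"
        using lim[of N] by (simp add: cont[OF hc hb])
    qed simp
    then show ?thesis by (simp add: sets_eq_imp_space_eq[OF sets(1)] sets_eq_imp_space_eq[OF sets(2)])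
  qed
  show ?thesis
  proof (rule measure_eqI_generator_eq[where E = "range atMost" and \<Omega> = UNIV and A = "\<lambda>n. {..real n}"])
    show "Int_stable (range (atMost :: real \<Rightarrow> _))"
      by (auto simp: Int_stable_def)
    show "emeasure M X = emeasure N X" if "X \<in> range atMost" for X
      using that half by (auto simp: M.emeasure_eq_measure N.emeasure_eq_measure)
    show "sets M = sigma_sets UNIV (range atMost)" "sets N = sigma_sets UNIV (range atMost)"
      using sets by (simp_all add: borel_eq_atMost)
    show "(\<Union>n. {..real n}) = UNIV" by (auto simp: real_arch_simple)
  qed auto
qed

text \<open>
  Tilting by \<open>exp (- v x)\<close> makes the measures finite, and the substitution \<open>y = exp (- x)\<close> turns the
  transform at \<open>v + k\<close> into the \<open>k\<close>-th moment of a measure on the unit interval. Both operations can be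
  undone.
\<close>

lemma measure_eqI_laplace:
  fixes M N :: "real measure"
  assumes sets: "sets M = sets borel" "sets N = sets borel"
    and supp: "emeasure M {..<0} = 0" "emeasure N {..<0} = 0"
    and eq: "\<And>u. u > b \<Longrightarrow> (\<integral>\<^sup>+x. ennreal (exp (- (u * x))) \<partial>M) = (\<integral>\<^sup>+x. ennreal (exp (- (u * x))) \<partial>N)"
    and fin: "\<And>u. u > b \<Longrightarrow> (\<integral>\<^sup>+x. ennreal (exp (- (u * x))) \<partial>M) < \<infinity>"
  shows "M = N"
proof -
  define v where "v = b + 1"
  define \<tau> where "\<tau> L = distr (density L (\<lambda>x. ennreal (exp (- (v * x))))) borel (\<lambda>x. exp (- x))"
    for L :: "real measure"
  have main: "finite_measure (\<tau> L) \<and> (AE x in \<tau> L. x \<in> {0..1}) \<and>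
      (\<forall>k. (LINT x|\<tau> L. x ^ k) = enn2real (\<integral>\<^sup>+x. ennreal (exp (- ((v + real k) * x))) \<partial>L)) \<and>
      density (distr (\<tau> L) borel (\<lambda>y. - ln y)) (\<lambda>x. ennreal (exp (v * x))) = L"
    if L: "sets L = sets borel" "emeasure L {..<0} = 0" "(\<integral>\<^sup>+x. ennreal (exp (- (v * x))) \<partial>L) < \<infinity>" for L
  proof (intro conjI allI)
    have [measurable_cong]: "sets L = sets borel" by fact
    have spL: "space L = UNIV" using sets_eq_imp_space_eq[OF L(1)] by simp
    have ae: "AE x in L. 0 \<le> x"
      by (rule AE_I[of _ _ "{..<0}"]) (use L in auto)
    show "finite_measure (\<tau> L)"
      by (rule finite_measureI)
        (use L(3) in \<open>simp add: \<tau>_def emeasure_distr emeasure_density spL\<close>)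
    show "AE x in \<tau> L. x \<in> {0..1}"
      unfolding \<tau>_def using ae by (subst AE_distr_iff) (auto simp: AE_density)
    show "(LINT x|\<tau> L. x ^ k) = enn2real (\<integral>\<^sup>+x. ennreal (exp (- ((v + real k) * x))) \<partial>L)" for k
    proof -
      have "(LINT x|\<tau> L. x ^ k) = (LINT x|L. exp (- (v * x)) * exp (- x) ^ k)"
        by (simp add: \<tau>_def integral_distr integral_density)
      also have "\<dots> = (LINT x|L. exp (- ((v + real k) * x)))"
        by (simp add: exp_of_nat_mult[symmetric] exp_add[symmetric] algebra_simps)
      finally show ?thesis by (simp add: integral_eq_nn_integral)
    qed
    have "distr (\<tau> L) borel (\<lambda>y. - ln y) = distr (density L (\<lambda>x. ennreal (exp (- (v * x))))) borel (\<lambda>x. x)"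
      by (simp add: \<tau>_def distr_distr comp_def)
    also have "\<dots> = density L (\<lambda>x. ennreal (exp (- (v * x))))"
      by (rule distr_id2) (simp add: L)
    finally show "density (distr (\<tau> L) borel (\<lambda>y. - ln y)) (\<lambda>x. ennreal (exp (v * x))) = L"
      by (simp add: density_density_eq ennreal_mult[symmetric] exp_add[symmetric] density_1)
  qed
  have v: "v > b" by (simp add: v_def)
  note m = main[OF sets(1) supp(1) fin[OF v]]
  note n = main[OF sets(2) supp(2) fin[OF v, unfolded eq[OF v]]]
  have "\<tau> M = \<tau> N"
    by (rule finite_measure_eqI_moments) (use m n eq v in \<open>auto simp: \<tau>_def v_def\<close>)
  then show ?thesis using m n by metis
qed

text \<open>
  A signed identity between transforms is used by moving negative parts to the other side, hence sums
  of possibly infinite measures.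
\<close>

definition measure_plus :: "'a measure \<Rightarrow> 'a measure \<Rightarrow> 'a measure" where
  "measure_plus M N = measure_of (space M) (sets M) (\<lambda>A. emeasure M A + emeasure N A)"

lemma sets_measure_plus [simp, measurable_cong]: "sets (measure_plus M N) = sets M"
  by (simp add: measure_plus_def)

lemma emeasure_measure_plus:
  assumes "sets N = sets M" "A \<in> sets M"
  shows "emeasure (measure_plus M N) A = emeasure M A + emeasure N A"
  unfolding measure_plus_def
proof (rule emeasure_measure_of_sigma)
  show "sigma_algebra (space M) (sets M)" ..
  show "positive (sets M) (\<lambda>A. emeasure M A + emeasure N A)" by (simp add: positive_def)
  show "countably_additive (sets M) (\<lambda>A. emeasure M A + emeasure N A)"
  proof (rule countably_additiveI)
    fix F :: "nat \<Rightarrow> _" assume F: "range F \<subseteq> sets M" "disjoint_family F"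
    then have "(\<Sum>i. emeasure M (F i)) = emeasure M (\<Union>i. F i)"
        "(\<Sum>i. emeasure N (F i)) = emeasure N (\<Union>i. F i)"
      using assms by (auto intro!: suminf_emeasure)
    then show "(\<Sum>i. emeasure M (F i) + emeasure N (F i)) = emeasure M (\<Union> (range F)) + emeasure N (\<Union> (range F))"
      by (simp add: suminf_add[symmetric])
  qed
qed fact

lemma nn_integral_measure_plus:
  assumes s: "sets N = sets M" and f: "f \<in> borel_measurable M"
  shows "(\<integral>\<^sup>+x. f x \<partial>measure_plus M N) = (\<integral>\<^sup>+x. f x \<partial>M) + (\<integral>\<^sup>+x. f x \<partial>N)"
  using f
proof (induction rule: borel_measurable_induct)
  have sp: "space N = space M" by (rule sets_eq_imp_space_eq[OF s])
  have sp': "space (measure_plus M N) = space M" by (rule sets_eq_imp_space_eq) simp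
  have [measurable_cong]: "sets N = sets M" by fact
  {
    case (cong f g)
    have "(\<integral>\<^sup>+x. f x \<partial>L) = (\<integral>\<^sup>+x. g x \<partial>L)" if "space L = space M" for L
      using cong(3) that by (intro nn_integral_cong) simp
    with cong show ?case by (simp add: sp sp')
  next
    case (set A)
    then show ?case by (simp add: emeasure_measure_plus s)
  next
    case (mult u c)
    then have [measurable]: "u \<in> borel_measurable M" by simp
    show ?case using mult by (simp add: nn_integral_cmult distrib_left)
  next
    case (add u v)
    then have [measurable]: "u \<in> borel_measurable M" "v \<in> borel_measurable M" by simp_all
    show ?case using add by (simp add: nn_integral_add ac_simps)
  next
    case (seq U)
    then have [measurable]: "U i \<in> borel_measurable M" for i by simp
    have *: "(\<integral>\<^sup>+x. f x \<partial>L) = (SUP i. \<integral>\<^sup>+x. U i x \<partial>L)" if [measurable_cong]: "sets L = sets M" for L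
    proof -
      have "(\<integral>\<^sup>+x. f x \<partial>L) = (\<integral>\<^sup>+x. (SUP i. U i x) \<partial>L)"
        by (simp add: \<open>f = (SUP i. U i)\<close> SUP_apply image_comp)
      also have "\<dots> = (SUP i. \<integral>\<^sup>+x. U i x \<partial>L)"
        using \<open>incseq U\<close> by (intro nn_integral_monotone_convergence_SUP) auto
      finally show ?thesis .
    qed
    have i: "incseq (\<lambda>i. \<integral>\<^sup>+x. U i x \<partial>L)" for L
      using \<open>incseq U\<close> by (auto intro!: nn_integral_mono simp: incseq_def le_fun_def)
    have "(\<integral>\<^sup>+x. f x \<partial>measure_plus M N) = (SUP i. (\<integral>\<^sup>+x. U i x \<partial>M) + (\<integral>\<^sup>+x. U i x \<partial>N))"
      unfolding *[OF sets_measure_plus] by (intro SUP_cong refl seq)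
    also have "\<dots> = (\<integral>\<^sup>+x. f x \<partial>M) + (\<integral>\<^sup>+x. f x \<partial>N)"
      unfolding *[OF refl] *[OF s] by (rule ennreal_SUP_add[OF i i])
    finally show ?case unfolding \<open>f = (SUP i. U i)\<close> .
  }
qed

section \<open>Transforms expanded in powers of the argument\<close>

lemma nn_integral_power_exp:
  fixes a u :: real
  assumes a: "a > 0" and u: "u > 0"
  shows "(\<integral>\<^sup>+x. ennreal (indicator {0<..} x * x powr (a - 1) / Gamma a) * ennreal (exp (- (u * x))) \<partial>lborel)
    = ennreal (u powr (- a))"
proof -
  have G: "Gamma a > 0" using a by (rule Gamma_real_pos)
  define F where "F x = ennreal (indicator {0<..} x * x powr (a - 1) / Gamma a) * ennreal (exp (- (u * x)))" for x
  have [measurable]: "F \<in> borel_measurable borel" unfolding F_def by measurable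
  have pt: "ennreal (indicator {0..} (0 + u * x) * (0 + u * x) powr (a - 1) / exp (0 + u * x))
      = ennreal (u powr (a - 1) * Gamma a) * F x" for x
  proof (cases "x > 0")
    case True
    then show ?thesis using u G
      by (simp add: F_def ennreal_mult[symmetric] powr_mult exp_minus divide_inverse ac_simps)
  next
    case False
    then show ?thesis using u by (cases "x = 0") (auto simp: F_def indicator_def zero_le_mult_iff)
  qed
  have "ennreal (Gamma a) = (\<integral>\<^sup>+t. ennreal (indicator {0..} t * t powr (a - 1) / exp t) \<partial>lborel)"
    using Gamma_conv_nn_integral_real[OF a] .
  also have "\<dots> = \<bar>u\<bar> * (\<integral>\<^sup>+x. ennreal (indicator {0..} (0 + u * x) * (0 + u * x) powr (a - 1) / exp (0 + u * x)) \<partial>lborel)"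
    using u by (intro nn_integral_real_affine) auto
  also have "\<dots> = \<bar>u\<bar> * (ennreal (u powr (a - 1) * Gamma a) * (\<integral>\<^sup>+x. F x \<partial>lborel))"
    by (simp only: pt) (simp add: nn_integral_cmult)
  also have "\<dots> = ennreal (u * (u powr (a - 1) * Gamma a)) * (\<integral>\<^sup>+x. F x \<partial>lborel)"
    using u G by (simp add: mult.assoc ennreal_mult)
  also have "u * (u powr (a - 1) * Gamma a) = u powr a * Gamma a"
    using u by (simp add: powr_diff)
  finally have *: "ennreal (Gamma a) = ennreal (u powr a * Gamma a) * (\<integral>\<^sup>+x. F x \<partial>lborel)" (is "_ = _ * ?I") .
  have "ennreal (u powr (- a)) = ennreal (u powr (- a) / Gamma a) * ennreal (Gamma a)"
    using G by (simp add: ennreal_mult[symmetric])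
  also have "\<dots> = ennreal (u powr (- a) / Gamma a * (u powr a * Gamma a)) * ?I"
    using G u by (subst *) (simp add: ennreal_mult[symmetric] mult.assoc[symmetric])
  also have "u powr (- a) / Gamma a * (u powr a * Gamma a) = 1"
    using G u by (simp add: powr_minus field_simps)
  finally show ?thesis by (simp add: F_def)
qed

text \<open>
  The termwise inverse Laplace transform of \<open>\<Sum>k. c k * (u powr - \<alpha>) ^ Suc k\<close>. For \<open>c k = (- 1) ^ k\<close>
  the same series would be the Mittag-Leffler density; the values in \<open>ennreal\<close> restrict the coefficients
  to nonnegative ones but make every interchange of sum and integral automatic.
\<close>

definition gamma_series_measure :: "real \<Rightarrow> (nat \<Rightarrow> real) \<Rightarrow> real measure" where
  "gamma_series_measure \<alpha> c = density lborel
     (\<lambda>x. \<Sum>k. ennreal (c k) * ennreal (indicator {0<..} x * x powr (\<alpha> * real (Suc k) - 1) / Gamma (\<alpha> * real (Suc k))))"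

lemma laplace_gamma_series_measure:
  assumes \<alpha>: "\<alpha> > 0" and u: "u > 0" and c: "\<And>k. 0 \<le> c k"
    and s: "summable (\<lambda>k. c k * inverse (u powr \<alpha>) ^ Suc k)"
  shows "(\<integral>\<^sup>+x. ennreal (exp (- (u * x))) \<partial>gamma_series_measure \<alpha> c)
    = ennreal (\<Sum>k. c k * inverse (u powr \<alpha>) ^ Suc k)"
proof -
  have "(\<integral>\<^sup>+x. ennreal (exp (- (u * x))) \<partial>gamma_series_measure \<alpha> c)
    = (\<integral>\<^sup>+x. (\<Sum>k. ennreal (c k) * (ennreal (indicator {0<..} x * x powr (\<alpha> * real (Suc k) - 1) / Gamma (\<alpha> * real (Suc k)))
         * ennreal (exp (- (u * x))))) \<partial>lborel)"
    unfolding gamma_series_measure_def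
    by (subst nn_integral_density) (auto simp: mult.assoc[symmetric] intro!: nn_integral_cong)
  also have "\<dots> = (\<Sum>k. ennreal (c k) * (\<integral>\<^sup>+x. ennreal (indicator {0<..} x * x powr (\<alpha> * real (Suc k) - 1) / Gamma (\<alpha> * real (Suc k)))
         * ennreal (exp (- (u * x))) \<partial>lborel))"
    by (subst nn_integral_suminf) (auto simp: nn_integral_cmult)
  also have "\<dots> = (\<Sum>k. ennreal (c k * inverse (u powr \<alpha>) ^ Suc k))"
  proof (rule suminf_cong)
    fix k
    have "u powr (- (\<alpha> * real (Suc k))) = inverse (u powr \<alpha>) ^ Suc k"
      using u by (metis powr_minus powr_powr powr_realpow powr_gt_zero power_inverse less_irrefl)
    then show "ennreal (c k) * (\<integral>\<^sup>+x. ennreal (indicator {0<..} x * x powr (\<alpha> * real (Suc k) - 1) / Gamma (\<alpha> * real (Suc k)))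
         * ennreal (exp (- (u * x))) \<partial>lborel) = ennreal (c k * inverse (u powr \<alpha>) ^ Suc k)"
      using nn_integral_power_exp[of "\<alpha> * real (Suc k)" u] \<alpha> u c by (simp add: ennreal_mult)
  qed
  also have "\<dots> = ennreal (\<Sum>k. c k * inverse (u powr \<alpha>) ^ Suc k)"
    using c s by (intro suminf_ennreal2) auto
  finally show ?thesis .
qed

text \<open>
  With \<open>P\<close> and \<open>N\<close> the absolutely continuous measures belonging to the positive and the negative parts
  of the coefficients, the transforms of \<open>\<mu> + N\<close> and of \<open>q\<close> times the unit mass plus \<open>P\<close> agree for
  large arguments, so these measures agree. Evaluating them on null sets gives both claims.
\<close>

lemma atom_and_ac_from_laplace_expansion:
  fixes \<mu> :: "real measure"
  assumes \<alpha>: "\<alpha> > 0" and fin: "finite_measure \<mu>" and sets: "sets \<mu> = sets borel"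
    and supp: "emeasure \<mu> {..<0} = 0" and q: "q \<ge> 0" and C: "C > 0"
    and c_bound: "\<forall>k. \<bar>c k\<bar> \<le> B * C ^ k"
    and lt: "\<And>u. u > 0 \<Longrightarrow> u powr \<alpha> > C \<Longrightarrow>
       (LINT x|\<mu>. exp (- (u * x))) = q + (\<Sum>k. c k * inverse (u powr \<alpha>) ^ Suc k)"
  shows "emeasure \<mu> {0} = ennreal q"
    and "\<And>A. A \<in> null_sets lborel \<Longrightarrow> 0 \<notin> A \<Longrightarrow> A \<in> sets borel \<Longrightarrow> emeasure \<mu> A = 0"
proof -
  interpret finite_measure \<mu> by fact
  have c: "\<bar>c k\<bar> \<le> B * C ^ k" for k using c_bound ..
  have [measurable_cong]: "sets \<mu> = sets borel" by fact
  have sp: "space \<mu> = UNIV" using sets_eq_imp_space_eq[OF sets] by simp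
  define P where "P = gamma_series_measure \<alpha> (\<lambda>k. max 0 (c k))"
  define N where "N = gamma_series_measure \<alpha> (\<lambda>k. max 0 (- c k))"
  define \<delta> where "\<delta> = density (return borel (0::real)) (\<lambda>_. ennreal q)"
  have sPN [measurable_cong]: "sets P = sets borel" "sets N = sets borel" "sets \<delta> = sets borel"
    by (auto simp: P_def N_def \<delta>_def gamma_series_measure_def)
  have neg: "emeasure (gamma_series_measure \<alpha> d) {..0} = 0" for d
    unfolding gamma_series_measure_def
    by (subst emeasure_density) (auto intro!: nn_integral_zero' AE_I2 simp: indicator_def)
  have null: "emeasure (gamma_series_measure \<alpha> d) A = 0" if "A \<in> null_sets lborel" for d A
    using that unfolding gamma_series_measure_def
    by (subst emeasure_density) (auto intro!: nn_integral_null_set simp: null_setsD2)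
  have \<delta>: "emeasure \<delta> A = ennreal q * indicator A 0" if "A \<in> sets borel" for A
    using that by (simp add: \<delta>_def emeasure_density nn_integral_return)
  \<comment> \<open>Beyond \<open>C powr (1 / \<alpha>)\<close> the variable of the power series lies inside its disc of convergence.\<close>
  have eq: "measure_plus \<mu> N = measure_plus \<delta> P"
  proof (rule measure_eqI_laplace[where b = "C powr (1 / \<alpha>)"])
    show "sets (measure_plus \<mu> N) = sets borel" "sets (measure_plus \<delta> P) = sets borel"
      by (simp_all add: sPN sets)
    have "emeasure L {..<0} = 0" if "L = P \<or> L = N" for L
    proof -
      have "emeasure L {..<0} \<le> emeasure L {..0}" by (rule emeasure_mono) (use that sPN in auto)
      then show ?thesis using neg that unfolding P_def N_def by auto
    qed
    then show "emeasure (measure_plus \<mu> N) {..<0} = 0" "emeasure (measure_plus \<delta> P) {..<0} = 0"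
      by (simp_all add: emeasure_measure_plus sPN sets supp \<delta>)
    fix u assume u: "u > C powr (1 / \<alpha>)"
    have u0: "u > 0" using u by (smt (verit) powr_ge_zero)
    have "(C powr (1 / \<alpha>)) powr \<alpha> < u powr \<alpha>" using u \<alpha> by (intro powr_less_mono2) auto
    then have uC: "u powr \<alpha> > C" using \<alpha> C by (simp add: powr_powr)
    define y where "y = inverse (u powr \<alpha>)"
    have y: "0 < y" "C * y < 1" using uC u0 C by (auto simp: y_def field_simps)
    have B: "B \<ge> 0" using c[of 0] by simp
    have sum: "summable (\<lambda>k. d k * y ^ Suc k)" if "\<And>k. \<bar>d k\<bar> \<le> \<bar>c k\<bar>" for d
    proof (rule summable_comparison_test')
      show "summable (\<lambda>k. B * y * (C * y) ^ k)"
        using y C by (intro summable_mult summable_geometric) auto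
      show "norm (d k * y ^ Suc k) \<le> B * y * (C * y) ^ k" if "k \<ge> 0" for k
        using mult_right_mono[OF order_trans[OF \<open>\<bar>d k\<bar> \<le> \<bar>c k\<bar>\<close> c], of "y ^ Suc k"] y
        by (simp add: abs_mult power_mult_distrib algebra_simps)
    qed
    have sp: "summable (\<lambda>k. max 0 (c k) * y ^ Suc k)" and sn: "summable (\<lambda>k. max 0 (- c k) * y ^ Suc k)"
      by (rule sum; simp)+
    have P: "(\<integral>\<^sup>+x. ennreal (exp (- (u * x))) \<partial>P) = ennreal (\<Sum>k. max 0 (c k) * y ^ Suc k)"
      unfolding P_def y_def using \<alpha> u0 sp[unfolded y_def] by (intro laplace_gamma_series_measure) auto
    have N: "(\<integral>\<^sup>+x. ennreal (exp (- (u * x))) \<partial>N) = ennreal (\<Sum>k. max 0 (- c k) * y ^ Suc k)"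
      unfolding N_def y_def using \<alpha> u0 sn[unfolded y_def] by (intro laplace_gamma_series_measure) auto
    have D: "(\<integral>\<^sup>+x. ennreal (exp (- (u * x))) \<partial>\<delta>) = ennreal q"
      by (simp add: \<delta>_def nn_integral_density nn_integral_return)
    have ae: "AE x in \<mu>. 0 \<le> x" by (rule AE_I[of _ _ "{..<0}"]) (use supp sets in auto)
    have "integrable \<mu> (\<lambda>x. exp (- (u * x)))"
      by (rule integrable_const_bound[where B = 1]) (use ae u0 in auto)
    then have M: "(\<integral>\<^sup>+x. ennreal (exp (- (u * x))) \<partial>\<mu>) = ennreal (q + (\<Sum>k. c k * y ^ Suc k))"
      using lt[OF u0 uC] by (simp add: nn_integral_eq_integral y_def)
    have nonneg: "q + (\<Sum>k. c k * y ^ Suc k) \<ge> 0"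
      unfolding y_def lt[OF u0 uC, symmetric] by (rule Bochner_Integration.integral_nonneg) simp
    have "(\<Sum>k. c k * y ^ Suc k) = (\<Sum>k. max 0 (c k) * y ^ Suc k - max 0 (- c k) * y ^ Suc k)"
      by (intro suminf_cong) (auto simp: max_def)
    also have "\<dots> = (\<Sum>k. max 0 (c k) * y ^ Suc k) - (\<Sum>k. max 0 (- c k) * y ^ Suc k)"
      using sp sn by (rule suminf_diff[symmetric])
    finally have split: "q + (\<Sum>k. c k * y ^ Suc k) + (\<Sum>k. max 0 (- c k) * y ^ Suc k) = q + (\<Sum>k. max 0 (c k) * y ^ Suc k)"
      by simp
    have nn: "(\<Sum>k. max 0 (- c k) * y ^ Suc k) \<ge> 0" "(\<Sum>k. max 0 (c k) * y ^ Suc k) \<ge> 0"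
      using sp sn y by (auto intro!: suminf_nonneg)
    have l: "(\<integral>\<^sup>+x. ennreal (exp (- (u * x))) \<partial>measure_plus \<mu> N) = ennreal (q + (\<Sum>k. c k * y ^ Suc k) + (\<Sum>k. max 0 (- c k) * y ^ Suc k))"
      using nonneg nn by (simp add: nn_integral_measure_plus sPN sets M N ennreal_plus[symmetric] del: ennreal_plus)
    show "(\<integral>\<^sup>+x. ennreal (exp (- (u * x))) \<partial>measure_plus \<mu> N) = (\<integral>\<^sup>+x. ennreal (exp (- (u * x))) \<partial>measure_plus \<delta> P)"
      unfolding l split using nn q
      by (simp add: nn_integral_measure_plus sPN D P ennreal_plus[symmetric] del: ennreal_plus)
    show "(\<integral>\<^sup>+x. ennreal (exp (- (u * x))) \<partial>measure_plus \<mu> N) < \<infinity>"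
      unfolding l by simp
  qed
  have *: "emeasure \<mu> A + emeasure N A = emeasure \<delta> A + emeasure P A" if "A \<in> sets borel" for A
    using arg_cong[OF eq, of "\<lambda>M. emeasure M A"] that by (simp add: emeasure_measure_plus sPN sets)
  have nullP: "emeasure N A = 0" "emeasure P A = 0" if "A \<in> null_sets lborel" for A
    using null[OF that] by (auto simp: N_def P_def)
  have null0: "{0::real} \<in> null_sets lborel" by (auto simp: null_sets_def)
  show "emeasure \<mu> {0} = ennreal q"
    using *[of "{0}"] nullP[of "{0}"] null0 \<delta>[of "{0}"] by simp
  show "emeasure \<mu> A = 0" if "A \<in> null_sets lborel" "0 \<notin> A" "A \<in> sets borel" for A
    using *[of A] nullP[of A] \<delta>[of A] that by simp
qed

section \<open>Nonsingular M-matrices\<close>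

text \<open>
  Entries of products are expanded into sums over initial segments, which is why the form with a
  scalar product of a row is kept out of the simplifier.
\<close>

declare index_mult_mat_vec [simp del]

lemma index_mult_mat_vec_sum:
  assumes "A \<in> carrier_mat m k" "x \<in> carrier_vec k" "i < m"
  shows "(A *\<^sub>v x) $ i = (\<Sum>j<k. A $$ (i, j) * x $ j)"
  using assms by (auto simp: mult_mat_vec_def scalar_prod_def atLeast0LessThan intro!: sum.cong)

lemma mult_mat_vec_uminus:
  fixes A :: "real Matrix.mat"
  assumes "A \<in> carrier_mat m k" "x \<in> carrier_vec k"
  shows "A *\<^sub>v (- x) = - (A *\<^sub>v x)"
  using assms by (intro eq_vecI) (auto simp: index_mult_mat_vec intro!: scalar_prod_uminus_right)

lemma scalar_prod_eq_sum: "x \<in> carrier_vec k \<Longrightarrow> y \<bullet> x = (\<Sum>i<k. y $ i * x $ i)"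
  by (auto simp: scalar_prod_def atLeast0LessThan)

lemma ones_simps [simp]: "ones k \<in> carrier_vec k" "dim_vec (ones k) = k" "i < k \<Longrightarrow> ones k $ i = 1"
  by (simp_all add: ones_def)

lemma mat_inv_of_det:
  assumes "A \<in> carrier_mat k k" "det A \<noteq> 0"
  shows "mat_inv A \<in> carrier_mat k k" "A * mat_inv A = 1\<^sub>m k" "mat_inv A * A = 1\<^sub>m k"
proof -
  obtain B where "mat_inverse A = Some B"
    using mat_inverse(1)[OF assms(1), where b = "()"] det_non_zero_imp_unit[OF assms, where b = "()"]
    by (cases "mat_inverse A") auto
  with mat_inverse(2)[OF assms(1) this]
  show "mat_inv A \<in> carrier_mat k k" "A * mat_inv A = 1\<^sub>m k" "mat_inv A * A = 1\<^sub>m k"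
    by (simp_all add: mat_inv_def)
qed

lemma mat_inv_eqI:
  assumes A: "A \<in> carrier_mat k k" and B: "B \<in> carrier_mat k k" and BA: "B * A = 1\<^sub>m k"
  shows "mat_inv A = B"
proof -
  have "det A \<noteq> 0" using det_mult[OF B A] BA by auto
  note i = mat_inv_of_det[OF A this]
  have "mat_inv A = (B * A) * mat_inv A" using i BA by simp
  also have "\<dots> = B * (A * mat_inv A)" using A B i by (intro assoc_mult_mat)
  finally show ?thesis using i B by simp
qed

lemma mult_mat_vec_nonneg:
  fixes A :: "real Matrix.mat"
  assumes "A \<in> carrier_mat m k" "x \<in> carrier_vec k" "i < m"
    and "\<And>j. j < k \<Longrightarrow> 0 \<le> A $$ (i, j)" "\<And>j. j < k \<Longrightarrow> 0 \<le> x $ j"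
  shows "0 \<le> (A *\<^sub>v x) $ i"
  using assms by (auto simp: index_mult_mat_vec_sum intro!: sum_nonneg mult_nonneg_nonneg)

lemma sum_abs_mult_mat_vec_le:
  fixes A :: "real Matrix.mat"
  assumes A: "A \<in> carrier_mat m k" and x: "x \<in> carrier_vec k"
  shows "(\<Sum>i<m. \<bar>(A *\<^sub>v x) $ i\<bar>) \<le> (\<Sum>i<m. \<Sum>j<k. \<bar>A $$ (i, j)\<bar>) * (\<Sum>j<k. \<bar>x $ j\<bar>)"
proof -
  have "\<bar>(A *\<^sub>v x) $ i\<bar> \<le> (\<Sum>j<k. \<bar>A $$ (i, j)\<bar> * (\<Sum>j<k. \<bar>x $ j\<bar>))" if "i < m" for i
  proof -
    have "\<bar>(A *\<^sub>v x) $ i\<bar> \<le> (\<Sum>j<k. \<bar>A $$ (i, j) * x $ j\<bar>)"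
      unfolding index_mult_mat_vec_sum[OF A x that] by (rule sum_abs)
    also have "\<dots> \<le> (\<Sum>j<k. \<bar>A $$ (i, j)\<bar> * (\<Sum>j<k. \<bar>x $ j\<bar>))"
      unfolding abs_mult by (intro sum_mono mult_left_mono member_le_sum) auto
    finally show ?thesis .
  qed
  then show ?thesis by (auto simp: sum_distrib_right intro!: sum_mono)
qed

lemma mat_inv_diag_of:
  assumes d: "d \<in> carrier_vec k" "\<forall>i<k. d $ i > 0"
  shows "mat_inv (diag_of d) = mat_diag k (\<lambda>i. inverse (d $ i))"
proof (rule mat_inv_eqI[where k = k])
  show "mat_diag k (\<lambda>i. inverse (d $ i)) * diag_of d = 1\<^sub>m k"
  proof -
    have "mat_diag k (\<lambda>i. inverse (d $ i)) * diag_of d = mat_diag k (\<lambda>i. inverse (d $ i) * d $ i)"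
      using d(1) by (simp add: diag_of_def)
    also have "\<dots> = 1\<^sub>m k" using d by (intro eq_matI) (auto simp: mat_diag_def)
    finally show ?thesis .
  qed
qed (use d in \<open>auto simp: diag_of_def\<close>)

text \<open>
  Among the many equivalent characterizations of nonsingular M-matrices, generalized diagonal dominance
  (a positive \<open>z\<close> with \<open>B z > 0\<close>) is the one that passes to principal blocks and Schur complements by
  restricting \<open>z\<close>, and to larger diagonals with the same \<open>z\<close>.
\<close>

definition M_matrix :: "nat \<Rightarrow> real Matrix.mat \<Rightarrow> bool" where
  "M_matrix k B \<longleftrightarrow> B \<in> carrier_mat k k \<and> (\<forall>i<k. \<forall>j<k. i \<noteq> j \<longrightarrow> B $$ (i, j) \<le> 0) \<and>
     (\<exists>z\<in>carrier_vec k. \<forall>i<k. 0 < z $ i \<and> 0 < (B *\<^sub>v z) $ i)"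

lemma M_matrix_carrier: "M_matrix k B \<Longrightarrow> B \<in> carrier_mat k k"
  by (simp add: M_matrix_def)

text \<open>
  At an index \<open>l\<close> that minimizes \<open>x $ i / z $ i\<close>, with minimum \<open>m\<close>, the signs off the diagonal give
  \<open>(B x) $ l \<le> m * (B z) $ l\<close>; so \<open>m\<close> cannot be negative.
\<close>

lemma M_matrix_minimum_principle:
  assumes B: "M_matrix k B" and x: "x \<in> carrier_vec k"
    and Bx: "\<And>i. i < k \<Longrightarrow> 0 \<le> (B *\<^sub>v x) $ i" and i: "i < k"
  shows "0 \<le> x $ i"
proof (rule ccontr)
  assume neg: "\<not> 0 \<le> x $ i"
  from B obtain z where Bc: "B \<in> carrier_mat k k"
    and off: "\<And>i j. i < k \<Longrightarrow> j < k \<Longrightarrow> i \<noteq> j \<Longrightarrow> B $$ (i, j) \<le> 0"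
    and z: "z \<in> carrier_vec k" "\<And>i. i < k \<Longrightarrow> 0 < z $ i" "\<And>i. i < k \<Longrightarrow> 0 < (B *\<^sub>v z) $ i"
    unfolding M_matrix_def by blast
  define f where "f j = x $ j / z $ j" for j
  define m where "m = Min (f ` {..<k})"
  have "m \<in> f ` {..<k}" unfolding m_def using i by (intro Min_in) auto
  then obtain l where l: "l < k" "f l = m" by auto
  have min: "m \<le> f j" if "j < k" for j unfolding m_def using that by (intro Min_le) auto
  have "f i < 0" using neg z(2)[OF i] by (simp add: f_def divide_neg_pos)
  then have "m < 0" using min[OF i] by simp
  have xz: "m * z $ j \<le> x $ j" if "j < k" for j
    using min[OF that] z(2)[OF that] by (simp add: f_def field_simps)
  have xl: "x $ l = m * z $ l" using l z(2)[of l] by (simp add: f_def field_simps)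
  have "(B *\<^sub>v x) $ l = (\<Sum>j<k. B $$ (l, j) * x $ j)"
    using Bc x l by (simp add: index_mult_mat_vec_sum)
  also have "\<dots> \<le> (\<Sum>j<k. B $$ (l, j) * (m * z $ j))"
  proof (rule sum_mono)
    fix j assume "j \<in> {..<k}"
    then show "B $$ (l, j) * x $ j \<le> B $$ (l, j) * (m * z $ j)"
      using xz[of j] off[of l j] l xl by (cases "j = l") (auto intro: mult_left_mono_neg)
  qed
  also have "\<dots> = m * (B *\<^sub>v z) $ l"
    using Bc z(1) l by (simp add: index_mult_mat_vec_sum sum_distrib_left ac_simps)
  also have "\<dots> < 0" using \<open>m < 0\<close> z(3)[OF l(1)] by (simp add: mult_neg_pos)
  finally show False using Bx[OF l(1)] by simp
qed

text \<open>
  The minimum principle applied to \<open>v\<close> and \<open>- v\<close> shows that the kernel is trivial.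
\<close>

lemma M_matrix_det: assumes "M_matrix k B" shows "det B \<noteq> 0"
proof
  note Bc = M_matrix_carrier[OF assms]
  assume "det B = 0"
  then obtain v where v: "v \<in> carrier_vec k" "v \<noteq> 0\<^sub>v k" "B *\<^sub>v v = 0\<^sub>v k"
    using det_0_iff_vec_prod_zero_field[OF Bc] by auto
  have "v $ i = 0" if "i < k" for i
  proof -
    have "0 \<le> v $ i"
      by (rule M_matrix_minimum_principle[OF assms v(1) _ that]) (simp add: v)
    moreover have "B *\<^sub>v (- v) = 0\<^sub>v k"
      using v Bc by (simp add: mult_mat_vec_uminus)
    then have "0 \<le> (- v) $ i"
      by (intro M_matrix_minimum_principle[OF assms _ _ that]) (use v in auto)
    ultimately show ?thesis using v(1) that by simp
  qed
  with v(1,2) show False by (auto intro!: eq_vecI)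
qed

lemmas M_matrix_inv = mat_inv_of_det[OF M_matrix_carrier M_matrix_det]

lemma M_matrix_solve:
  assumes "M_matrix k B" "b \<in> carrier_vec k"
  shows "mat_inv B *\<^sub>v b \<in> carrier_vec k" "B *\<^sub>v (mat_inv B *\<^sub>v b) = b"
proof -
  note i = M_matrix_inv[OF assms(1,1)] and c = M_matrix_carrier[OF assms(1)]
  show "mat_inv B *\<^sub>v b \<in> carrier_vec k" using i assms by simp
  show "B *\<^sub>v (mat_inv B *\<^sub>v b) = b"
    using i c assms by (simp flip: assoc_mult_mat_vec[of _ k k _ k])
qed

lemma M_matrix_solution_unique:
  assumes "M_matrix k B" "x \<in> carrier_vec k" "B *\<^sub>v x = b"
  shows "x = mat_inv B *\<^sub>v b"
proof -
  note i = M_matrix_inv[OF assms(1,1)] and c = M_matrix_carrier[OF assms(1)]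
  have "mat_inv B *\<^sub>v (B *\<^sub>v x) = (mat_inv B * B) *\<^sub>v x"
    using i c assms by (intro assoc_mult_mat_vec[symmetric]) auto
  then show ?thesis using i assms by simp
qed

lemma M_matrix_inv_nonneg:
  assumes B: "M_matrix k B" and b: "b \<in> carrier_vec k" "\<And>i. i < k \<Longrightarrow> 0 \<le> b $ i" and i: "i < k"
  shows "0 \<le> (mat_inv B *\<^sub>v b) $ i"
  by (rule M_matrix_minimum_principle[OF B _ _ i]) (use M_matrix_solve[OF B b(1)] b(2) in auto)

lemma M_matrix_increase_diagonal:
  assumes B: "M_matrix k B" and C: "C \<in> carrier_mat k k"
    and off: "\<And>i j. i < k \<Longrightarrow> j < k \<Longrightarrow> i \<noteq> j \<Longrightarrow> C $$ (i, j) = B $$ (i, j)"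
    and diag: "\<And>i. i < k \<Longrightarrow> B $$ (i, i) \<le> C $$ (i, i)"
  shows "M_matrix k C"
proof -
  from B obtain z where Bc: "B \<in> carrier_mat k k"
    and offB: "\<And>i j. i < k \<Longrightarrow> j < k \<Longrightarrow> i \<noteq> j \<Longrightarrow> B $$ (i, j) \<le> 0"
    and z: "z \<in> carrier_vec k" "\<And>i. i < k \<Longrightarrow> 0 < z $ i" "\<And>i. i < k \<Longrightarrow> 0 < (B *\<^sub>v z) $ i"
    unfolding M_matrix_def by blast
  have "(B *\<^sub>v z) $ i \<le> (C *\<^sub>v z) $ i" if "i < k" for i
    using Bc C z(1) that
    by (simp add: index_mult_mat_vec_sum)
      (intro sum_mono mult_right_mono, metis diag lessThan_iff off order_refl, use z(2) in \<open>auto simp: less_imp_le\<close>)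
  then have "\<forall>i<k. 0 < z $ i \<and> 0 < (C *\<^sub>v z) $ i" using z by (meson less_le_trans)
  then show ?thesis unfolding M_matrix_def using C off offB z(1) by auto
qed

lemma invertible_mat_of_M_matrix_uminus:
  assumes "M_matrix k (- T)" "T \<in> carrier_mat k k"
  shows "invertible_mat T"
proof -
  note i = M_matrix_inv[OF assms(1,1)]
  have "T * (- mat_inv (- T)) = 1\<^sub>m k" "- mat_inv (- T) * T = 1\<^sub>m k"
    using i assms(2) by auto
  moreover have "- mat_inv (- T) \<in> carrier_mat k k" using i(1) by simp
  ultimately show ?thesis
    unfolding invertible_mat_def inverts_mat_def using assms(2)
    by (metis carrier_matD square_mat.simps)
qed

text \<open>
  The natural candidate for \<open>z\<close> is the solution of \<open>- T z = 1\<close>, the vector of mean absorption times.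
  Row sums may vanish, so diagonal dominance does not make it nonnegative at once. But \<open>\<epsilon> I - T\<close> is
  strictly diagonally dominant for \<open>\<epsilon> > 0\<close>, the corresponding solutions are nonnegative, and they
  tend to \<open>z\<close> because \<open>T\<close> is invertible.
\<close>

lemma sub_intensity_imp_M_matrix:
  assumes T: "sub_intensity_matrix p T"
  shows "M_matrix p (- T)"
proof -
  have Tc: "T \<in> carrier_mat p p" and off: "\<And>i j. i < p \<Longrightarrow> j < p \<Longrightarrow> i \<noteq> j \<Longrightarrow> 0 \<le> T $$ (i, j)"
    and row: "\<And>i. i < p \<Longrightarrow> (\<Sum>j<p. T $$ (i, j)) \<le> 0"
    using T by (auto simp: sub_intensity_matrix_def)
  have "invertible_mat T" using T by (simp add: sub_intensity_matrix_def)
  then obtain H0 where H0: "inverts_mat T H0" "inverts_mat H0 T" unfolding invertible_mat_def by auto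
  then have H0c: "H0 \<in> carrier_mat p p"
    using Tc unfolding inverts_mat_def by (metis carrier_matD carrier_matI index_mult_mat(2,3) index_one_mat(2,3))
  have TH: "T * H0 = 1\<^sub>m p" "H0 * T = 1\<^sub>m p" using H0 Tc H0c by (auto simp: inverts_mat_def)
  define z where "z = - (H0 *\<^sub>v ones p)"
  have zc: "z \<in> carrier_vec p" using H0c by (simp add: z_def)
  have Tz: "T *\<^sub>v z = - ones p"
  proof -
    have "T *\<^sub>v (H0 *\<^sub>v ones p) = ones p"
      using TH Tc H0c by (simp flip: assoc_mult_mat_vec[of _ p p _ p])
    moreover have "T *\<^sub>v z = - (T *\<^sub>v (H0 *\<^sub>v ones p))"
      unfolding z_def using Tc H0c by (intro mult_mat_vec_uminus) auto
    ultimately show ?thesis by simp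
  qed
  define C where "C = (\<Sum>i<p. \<Sum>j<p. \<bar>H0 $$ (i, j)\<bar>)"
  define Z where "Z = (\<Sum>i<p. \<bar>z $ i\<bar>)"
  have C0: "C \<ge> 0" and Z0: "Z \<ge> 0" by (auto simp: C_def Z_def intro!: sum_nonneg)
  \<comment> \<open>The solution \<open>x\<close> of the perturbed system satisfies \<open>x - z = \<epsilon> H0 x\<close>, where \<open>H0\<close> is the inverse of
    \<open>T\<close>; for \<open>\<epsilon> C \<le> 1 / 2\<close> this bounds first the norm of \<open>x\<close> by \<open>2 Z\<close> and then the difference.\<close>
  have approx: "- (2 * C * Z * \<epsilon>) \<le> z $ i" if e: "\<epsilon> > 0" "\<epsilon> * C \<le> 1 / 2" and i: "i < p" for \<epsilon> i
  proof -
    define B where "B = \<epsilon> \<cdot>\<^sub>m 1\<^sub>m p - T"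
    have Bc: "B \<in> carrier_mat p p" using Tc by (simp add: B_def minus_carrier_mat)
    have Bx: "(B *\<^sub>v x) $ i = \<epsilon> * x $ i - (T *\<^sub>v x) $ i" if "x \<in> carrier_vec p" "i < p" for x i
      using that Tc Bc
      by (simp add: index_mult_mat_vec_sum)
        (simp add: B_def left_diff_distrib sum_subtractf if_distrib[of "\<lambda>a. _ * a * _"] cong: if_cong)
    have "0 < (B *\<^sub>v ones p) $ i" if "i < p" for i
      using row[OF that] e that Tc by (simp add: Bx index_mult_mat_vec_sum)
    then have BM: "M_matrix p B"
      unfolding M_matrix_def using Bc Tc off by (auto simp: B_def intro!: bexI[of _ "ones p"])
    define x where "x = mat_inv B *\<^sub>v ones p"
    have xc: "x \<in> carrier_vec p" and Bxe: "B *\<^sub>v x = ones p"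
      using M_matrix_solve[OF BM, of "ones p"] by (auto simp: x_def)
    have x0: "0 \<le> x $ i" if "i < p" for i
      unfolding x_def by (rule M_matrix_inv_nonneg[OF BM]) (use that in auto)
    have "T *\<^sub>v (x - z) = \<epsilon> \<cdot>\<^sub>v x"
    proof (rule eq_vecI)
      fix i assume "i < dim_vec (\<epsilon> \<cdot>\<^sub>v x)"
      then have i: "i < p" using xc by simp
      have "(T *\<^sub>v (x - z)) $ i = (T *\<^sub>v x) $ i - (T *\<^sub>v z) $ i"
        using Tc xc zc i by (simp add: index_mult_mat_vec_sum right_diff_distrib sum_subtractf)
      also have "\<dots> = \<epsilon> * x $ i" using Bx[OF xc i] Bxe Tz i by simp
      finally show "(T *\<^sub>v (x - z)) $ i = (\<epsilon> \<cdot>\<^sub>v x) $ i" using i xc by simp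
    qed (use Tc xc in auto)
    then have "(H0 * T) *\<^sub>v (x - z) = H0 *\<^sub>v (\<epsilon> \<cdot>\<^sub>v x)"
      using H0c Tc xc zc by (simp add: assoc_mult_mat_vec[of _ p p _ p])
    then have diff: "x - z = H0 *\<^sub>v (\<epsilon> \<cdot>\<^sub>v x)" using TH xc zc by simp
    define N where "N = (\<Sum>j<p. \<bar>x $ j\<bar>)"
    have N0: "N \<ge> 0" by (auto simp: N_def intro!: sum_nonneg)
    have "(\<Sum>i<p. \<bar>x $ i - z $ i\<bar>) = (\<Sum>i<p. \<bar>(H0 *\<^sub>v (\<epsilon> \<cdot>\<^sub>v x)) $ i\<bar>)"
      unfolding diff[symmetric] using xc zc by simp
    also have "\<dots> \<le> C * (\<Sum>j<p. \<bar>(\<epsilon> \<cdot>\<^sub>v x) $ j\<bar>)"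
      unfolding C_def using H0c xc by (intro sum_abs_mult_mat_vec_le) auto
    also have "\<dots> = \<epsilon> * C * N"
      using xc e by (simp add: N_def abs_mult sum_distrib_left[symmetric])
    finally have d: "(\<Sum>i<p. \<bar>x $ i - z $ i\<bar>) \<le> \<epsilon> * C * N" .
    have "N \<le> (\<Sum>i<p. \<bar>z $ i\<bar> + \<bar>x $ i - z $ i\<bar>)" unfolding N_def by (intro sum_mono) auto
    also have "\<dots> \<le> Z + \<epsilon> * C * N" using d by (simp add: sum.distrib Z_def)
    also have "\<epsilon> * C * N \<le> 1 / 2 * N" using e N0 by (intro mult_right_mono)
    finally have NZ: "N \<le> 2 * Z" by simp
    have "\<bar>x $ i - z $ i\<bar> \<le> (\<Sum>i<p. \<bar>x $ i - z $ i\<bar>)" using i by (intro member_le_sum) auto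
    also note d
    also have "\<epsilon> * C * N \<le> \<epsilon> * C * (2 * Z)" using e C0 NZ by (intro mult_left_mono) auto
    finally show ?thesis using x0[OF i] by (simp add: algebra_simps)
  qed
  have z0: "0 \<le> z $ i" if i: "i < p" for i
  proof (rule ccontr)
    assume neg: "\<not> 0 \<le> z $ i"
    define \<epsilon> where "\<epsilon> = min (1 / (2 * (C + 1))) (- z $ i / (4 * (C * Z + 1)))"
    have K: "C * Z + 1 > 0" using C0 Z0 by (simp add: add_nonneg_pos)
    have "- z $ i / (4 * (C * Z + 1)) > 0" using neg K by (intro divide_pos_pos) auto
    then have e: "\<epsilon> > 0" using C0 by (simp add: \<epsilon>_def)
    have e1: "\<epsilon> * C \<le> 1 / 2"
    proof -
      have "\<epsilon> * C \<le> 1 / (2 * (C + 1)) * (C + 1)" using C0 e by (intro mult_mono) (auto simp: \<epsilon>_def)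
      also have "\<dots> = 1 / 2" using C0 by (simp add: field_simps)
      finally show ?thesis .
    qed
    have "\<epsilon> * (4 * (C * Z + 1)) \<le> - z $ i"
    proof -
      have "\<epsilon> \<le> - z $ i / (4 * (C * Z + 1))" by (simp add: \<epsilon>_def)
      moreover have "0 < 4 * (C * Z + 1)" using K by simp
      ultimately show ?thesis using pos_le_divide_eq by blast
    qed
    moreover have "- z $ i \<le> 2 * C * Z * \<epsilon>" using approx[OF e e1 i] by simp
    moreover have "2 * C * Z * \<epsilon> \<ge> 0" using e C0 Z0 by simp
    ultimately show False using e by (simp add: algebra_simps)
  qed
  \<comment> \<open>At a zero of \<open>z\<close> the diagonal entry drops out of row \<open>i\<close> of \<open>T z = - 1\<close>, and the other terms of
    the row are nonnegative.\<close>
  have "0 < z $ i" if i: "i < p" for i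
  proof (rule ccontr)
    assume "\<not> 0 < z $ i"
    with z0[OF i] have zi: "z $ i = 0" by simp
    have "-1 = (\<Sum>j<p. T $$ (i, j) * z $ j)"
      using arg_cong[OF Tz, of "\<lambda>v. v $ i"] i Tc zc by (simp add: index_mult_mat_vec_sum)
    also have "\<dots> \<ge> 0"
      by (intro sum_nonneg) (metis i lessThan_iff mult_nonneg_nonneg mult_zero_right off order_refl z0 zi)
    finally show False by simp
  qed
  moreover have Bz: "(- T) *\<^sub>v z = ones p" using Tz Tc zc by simp
  ultimately have "\<forall>i<p. 0 < z $ i \<and> 0 < ((- T) *\<^sub>v z) $ i"
    unfolding Bz by simp
  then have pos: "\<exists>z\<in>carrier_vec p. \<forall>i<p. 0 < z $ i \<and> 0 < ((- T) *\<^sub>v z) $ i"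
    using zc by (rule bexI)
  show ?thesis
    unfolding M_matrix_def
  proof (intro conjI)
    show "- T \<in> carrier_mat p p" using Tc by simp
    show "\<forall>i<p. \<forall>j<p. i \<noteq> j \<longrightarrow> (- T) $$ (i, j) \<le> 0" using Tc off by simp
  qed (rule pos)
qed

section \<open>Elimination of a set of states\<close>

lemma bij_betw_pick: assumes "finite I" shows "bij_betw (pick I) {..<card I} I"
proof -
  have inj: "inj_on (pick I) {..<card I}"
    by (rule inj_onI) (metis lessThan_iff linorder_neqE_nat pick_mono_le less_irrefl)
  have "pick I ` {..<card I} \<subseteq> I" by (auto intro: pick_in_set_le)
  then have "pick I ` {..<card I} = I"
    using inj assms by (intro card_subset_eq) (simp_all add: card_image)
  with inj show ?thesis by (simp add: bij_betw_def)
qed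

lemma pick_lt: "I \<subseteq> {..<p} \<Longrightarrow> i < card I \<Longrightarrow> pick I i < p"
  using pick_in_set_le by blast

lemma subvec_carrier [simp]:
  "v \<in> carrier_vec p \<Longrightarrow> I \<subseteq> {..<p} \<Longrightarrow> subvec v I \<in> carrier_vec (card I)"
  unfolding subvec_def by (intro carrier_vecI) (auto intro!: arg_cong[where f = card])

lemma index_subvec:
  "v \<in> carrier_vec p \<Longrightarrow> I \<subseteq> {..<p} \<Longrightarrow> i < card I \<Longrightarrow> subvec v I $ i = v $ pick I i"
  using subvec_carrier[of v p I] unfolding subvec_def by auto

lemma submatrix_carrier [simp]:
  "A \<in> carrier_mat p q \<Longrightarrow> I \<subseteq> {..<p} \<Longrightarrow> J \<subseteq> {..<q} \<Longrightarrow>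
    submatrix A I J \<in> carrier_mat (card I) (card J)"
  by (intro carrier_matI) (auto simp: dim_submatrix intro!: arg_cong[where f = card])

lemma index_submatrix:
  assumes "A \<in> carrier_mat p q" "I \<subseteq> {..<p}" "J \<subseteq> {..<q}" "i < card I" "j < card J"
  shows "submatrix A I J $$ (i, j) = A $$ (pick I i, pick J j)"
  using submatrix_carrier[OF assms(1-3)] assms(4,5)
  by (intro submatrix_index) (auto simp: dim_submatrix)

lemma subvec_ones: "I \<subseteq> {..<p} \<Longrightarrow> subvec (ones p) I = ones (card I)"
  using subvec_carrier[of "ones p" p I]
  by (intro eq_vecI) (auto simp: index_subvec[of _ p] pick_lt)

lemma sum_lessThan_split:
  fixes f :: "nat \<Rightarrow> real"
  assumes "I \<union> J = {..<p}" "I \<inter> J = {}"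
  shows "(\<Sum>i<p. f i) = (\<Sum>a<card I. f (pick I a)) + (\<Sum>b<card J. f (pick J b))"
proof -
  have fin: "finite I" "finite J" using assms(1) by (metis finite_Un finite_lessThan)+
  have "(\<Sum>i<p. f i) = sum f I + sum f J"
    unfolding assms(1)[symmetric] using fin assms(2) by (rule sum.union_disjoint)
  then show ?thesis
    using sum.reindex_bij_betw[OF bij_betw_pick[OF fin(1)], of f]
      sum.reindex_bij_betw[OF bij_betw_pick[OF fin(2)], of f] by simp
qed

lemma scalar_prod_split:
  assumes "I \<union> J = {..<p}" "I \<inter> J = {}" "x \<in> carrier_vec p" "y \<in> carrier_vec p"
  shows "y \<bullet> x = subvec y I \<bullet> subvec x I + subvec y J \<bullet> subvec x J"
proof -
  have sub: "I \<subseteq> {..<p}" "J \<subseteq> {..<p}" using assms(1) by auto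
  show ?thesis
    using assms(3,4) sub
    by (simp add: scalar_prod_eq_sum[OF assms(3)] scalar_prod_eq_sum[OF subvec_carrier[OF assms(3)]]
        index_subvec[of _ p] sum_lessThan_split[OF assms(1,2)])
qed

lemma subvec_mult_mat_vec:
  assumes IJ: "I \<union> J = {..<p}" "I \<inter> J = {}" and A: "A \<in> carrier_mat p p" and x: "x \<in> carrier_vec p"
    and K: "K \<subseteq> {..<p}"
  shows "subvec (A *\<^sub>v x) K = submatrix A K I *\<^sub>v subvec x I + submatrix A K J *\<^sub>v subvec x J"
proof -
  have sub: "I \<subseteq> {..<p}" "J \<subseteq> {..<p}" using IJ(1) by auto
  have Ax: "A *\<^sub>v x \<in> carrier_vec p" using A x by simp
  note s = submatrix_carrier[OF A K sub(1)] submatrix_carrier[OF A K sub(2)]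
    subvec_carrier[OF x sub(1)] subvec_carrier[OF x sub(2)]
  show ?thesis
  proof (rule eq_vecI)
    fix i assume "i < dim_vec (submatrix A K I *\<^sub>v subvec x I + submatrix A K J *\<^sub>v subvec x J)"
    then have i: "i < card K" using s by simp
    have "subvec (A *\<^sub>v x) K $ i = (\<Sum>j<p. A $$ (pick K i, j) * x $ j)"
      using i K A x Ax by (simp add: index_subvec[of _ p] index_mult_mat_vec_sum pick_lt)
    also have "\<dots> = (submatrix A K I *\<^sub>v subvec x I) $ i + (submatrix A K J *\<^sub>v subvec x J) $ i"
      using s i sub A K x
      by (simp add: index_mult_mat_vec_sum[OF s(1,3)] index_mult_mat_vec_sum[OF s(2,4)]
          sum_lessThan_split[OF IJ] index_submatrix[of _ p p] index_subvec[of _ p])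
    finally show "subvec (A *\<^sub>v x) K $ i = (submatrix A K I *\<^sub>v subvec x I + submatrix A K J *\<^sub>v subvec x J) $ i"
      using s i by simp
  qed (use s subvec_carrier[OF Ax K] in simp)
qed

text \<open>
  The jump process is observed only while it is in \<open>I\<close>; the excursions into \<open>J\<close> are cut out.
\<close>

locale censored_sub_intensity =
  fixes p :: nat and T :: "real Matrix.mat" and I J :: "nat set"
  assumes T: "sub_intensity_matrix p T"
    and IJ: "I \<union> J = {..<p}" "I \<inter> J = {}"
begin

abbreviation "T\<^sub>I\<^sub>I \<equiv> submatrix T I I"
abbreviation "T\<^sub>I\<^sub>J \<equiv> submatrix T I J"
abbreviation "T\<^sub>J\<^sub>I \<equiv> submatrix T J I"
abbreviation "T\<^sub>J\<^sub>J \<equiv> submatrix T J J"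

text \<open>
  The Green matrix of the process killed when it leaves \<open>J\<close>.
\<close>

definition G :: "real Matrix.mat" where "G = mat_inv (- T\<^sub>J\<^sub>J)"

text \<open>
  The law of the state in which \<open>I\<close> is entered for the first time, for a start in \<open>J\<close>.
\<close>

definition W :: "real Matrix.mat" where "W = G * T\<^sub>J\<^sub>I"

text \<open>
  The Schur complement of the block \<open>J\<close>, which is the sub-intensity matrix of the censored process.
\<close>

definition S :: "real Matrix.mat" where "S = T\<^sub>I\<^sub>I + T\<^sub>I\<^sub>J * G * T\<^sub>J\<^sub>I"

text \<open>
  The probability of absorption before \<open>I\<close> is entered, for a start in \<open>J\<close>.
\<close>

definition g :: "real Matrix.vec" where "g = ones (card J) - W *\<^sub>v ones (card I)"

lemma sub: "I \<subseteq> {..<p}" "J \<subseteq> {..<p}" using IJ by auto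

lemma T_carrier: "T \<in> carrier_mat p p" using T by (simp add: sub_intensity_matrix_def)

lemma blocks [simp]:
  "T\<^sub>I\<^sub>I \<in> carrier_mat (card I) (card I)" "T\<^sub>I\<^sub>J \<in> carrier_mat (card I) (card J)"
  "T\<^sub>J\<^sub>I \<in> carrier_mat (card J) (card I)" "T\<^sub>J\<^sub>J \<in> carrier_mat (card J) (card J)"
  using submatrix_carrier[OF T_carrier] sub by auto

lemmas block_dims [simp] = blocks[THEN carrier_matD(1)] blocks[THEN carrier_matD(2)]

lemma off_nonneg: "i < p \<Longrightarrow> j < p \<Longrightarrow> i \<noteq> j \<Longrightarrow> 0 \<le> T $$ (i, j)"
  using T by (simp add: sub_intensity_matrix_def)

lemma block_off_nonneg:
  assumes "K = I \<or> K = J" "L = I \<or> L = J" "i < card K" "j < card L" "K = L \<Longrightarrow> i \<noteq> j"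
  shows "0 \<le> submatrix T K L $$ (i, j)"
proof -
  have KL: "K \<subseteq> {..<p}" "L \<subseteq> {..<p}" using assms sub by auto
  have "pick K i \<noteq> pick L j"
  proof (cases "K = L")
    case True
    then show ?thesis using assms(3,4,5) by (metis linorder_neqE_nat pick_mono_le less_irrefl)
  next
    case False
    then have "K \<inter> L = {}" using assms(1,2) IJ(2) by auto
    then show ?thesis using pick_in_set_le[OF assms(3)] pick_in_set_le[OF assms(4)] by auto
  qed
  then show ?thesis
    using assms(3,4) KL by (simp add: index_submatrix[OF T_carrier KL] off_nonneg pick_lt)
qed

lemma strictly_superharmonic:
  "\<exists>z\<in>carrier_vec p. (\<forall>i<p. 0 < z $ i) \<and> (\<forall>i<p. (T *\<^sub>v z) $ i < 0)"
proof -
  obtain z where z: "z \<in> carrier_vec p" "\<forall>i<p. 0 < z $ i \<and> 0 < ((- T) *\<^sub>v z) $ i"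
    using sub_intensity_imp_M_matrix[OF T] unfolding M_matrix_def by blast
  have "- T *\<^sub>v z = - (T *\<^sub>v z)" using z(1) T_carrier by simp
  with z T_carrier show ?thesis by auto
qed

text \<open>
  Leaving out the columns in \<open>I\<close> removes nonpositive terms from the rows of \<open>- T z > 0\<close>.
\<close>

lemma M_matrix_JJ: "M_matrix (card J) (- T\<^sub>J\<^sub>J)"
proof -
  obtain z where z: "z \<in> carrier_vec p" "\<And>i. i < p \<Longrightarrow> 0 < z $ i" "\<And>i. i < p \<Longrightarrow> (T *\<^sub>v z) $ i < 0"
    using strictly_superharmonic by blast
  have zI: "subvec z I \<in> carrier_vec (card I)" and zJ: "subvec z J \<in> carrier_vec (card J)"
    using z(1) sub by auto
  have "0 < ((- T\<^sub>J\<^sub>J) *\<^sub>v subvec z J) $ i" if i: "i < card J" for i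
  proof -
    have "(T\<^sub>J\<^sub>I *\<^sub>v subvec z I) $ i + (T\<^sub>J\<^sub>J *\<^sub>v subvec z J) $ i = subvec (T *\<^sub>v z) J $ i"
      using subvec_mult_mat_vec[OF IJ T_carrier z(1) sub(2)] blocks(4) i zI zJ by simp
    also have "\<dots> < 0"
      using z(3) i sub T_carrier z(1) by (simp add: index_subvec[of _ p] pick_lt)
    finally have "(T\<^sub>J\<^sub>I *\<^sub>v subvec z I) $ i + (T\<^sub>J\<^sub>J *\<^sub>v subvec z J) $ i < 0" .
    moreover have "0 \<le> (T\<^sub>J\<^sub>I *\<^sub>v subvec z I) $ i"
      using i z(1,2) sub IJ(2)
      by (intro mult_mat_vec_nonneg[OF blocks(3) zI]) (auto simp: index_subvec[of _ p] pick_lt less_imp_le intro!: block_off_nonneg)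
    ultimately show ?thesis using zJ i blocks(4) by simp
  qed
  moreover have "0 < subvec z J $ i" if "i < card J" for i
    using z sub that by (simp add: index_subvec[of _ p] pick_lt)
  ultimately have pos: "\<exists>z\<in>carrier_vec (card J). \<forall>i<card J. 0 < z $ i \<and> 0 < ((- T\<^sub>J\<^sub>J) *\<^sub>v z) $ i"
    using zJ by blast
  show ?thesis
    unfolding M_matrix_def
  proof (intro conjI)
    show "\<forall>i<card J. \<forall>j<card J. i \<noteq> j \<longrightarrow> (- T\<^sub>J\<^sub>J) $$ (i, j) \<le> 0"
      using block_off_nonneg[of J J] by simp
  qed (use pos in simp_all)
qed

lemma G_carrier [simp]: "G \<in> carrier_mat (card J) (card J)"
  unfolding G_def by (rule M_matrix_inv(1)[OF M_matrix_JJ M_matrix_JJ])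

lemma W_carrier [simp]: "W \<in> carrier_mat (card J) (card I)"
  unfolding W_def by (rule mult_carrier_mat[OF G_carrier blocks(3)])

lemma S_carrier [simp]: "S \<in> carrier_mat (card I) (card I)"
  unfolding S_def using mult_carrier_mat[OF mult_carrier_mat[OF blocks(2) G_carrier] blocks(3)] by simp

lemmas dims [simp] = G_carrier[THEN carrier_matD(1)] G_carrier[THEN carrier_matD(2)]
  W_carrier[THEN carrier_matD(1)] W_carrier[THEN carrier_matD(2)]
  S_carrier[THEN carrier_matD(1)] S_carrier[THEN carrier_matD(2)]

lemma S_eq: "S = T\<^sub>I\<^sub>I + T\<^sub>I\<^sub>J * W"
  unfolding S_def W_def using assoc_mult_mat[OF blocks(2) G_carrier blocks(3)] by simp

lemma S_mult: "x \<in> carrier_vec (card I) \<Longrightarrow> S *\<^sub>v x = T\<^sub>I\<^sub>I *\<^sub>v x + T\<^sub>I\<^sub>J *\<^sub>v (W *\<^sub>v x)"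
  unfolding S_eq using mult_carrier_mat[OF blocks(2) W_carrier]
  by (simp add: add_mult_distrib_mat_vec[OF blocks(1)] assoc_mult_mat_vec[OF blocks(2) W_carrier])

lemma W_mult: "x \<in> carrier_vec (card I) \<Longrightarrow> W *\<^sub>v x = G *\<^sub>v (T\<^sub>J\<^sub>I *\<^sub>v x)"
  unfolding W_def by (rule assoc_mult_mat_vec[OF G_carrier blocks(3)])

lemma g_carrier [simp]: "g \<in> carrier_vec (card J)"
  unfolding g_def by (intro minus_carrier_vec mult_mat_vec_carrier[OF W_carrier]) auto

lemma G_nonneg:
  "b \<in> carrier_vec (card J) \<Longrightarrow> (\<And>i. i < card J \<Longrightarrow> 0 \<le> b $ i) \<Longrightarrow> i < card J \<Longrightarrow> 0 \<le> (G *\<^sub>v b) $ i"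
  unfolding G_def by (rule M_matrix_inv_nonneg[OF M_matrix_JJ])

lemma G_solve:
  assumes "x \<in> carrier_vec (card J)" "T\<^sub>J\<^sub>J *\<^sub>v x = - b" "b \<in> carrier_vec (card J)"
  shows "x = G *\<^sub>v b"
  unfolding G_def using assms blocks(4)
  by (intro M_matrix_solution_unique[OF M_matrix_JJ]) auto

lemma W_nonneg: assumes "i < card J" "j < card I" shows "0 \<le> W $$ (i, j)"
proof -
  have c: "col T\<^sub>J\<^sub>I j \<in> carrier_vec (card J)" using blocks(3) assms by (metis col_carrier_vec)
  have "col W j = G *\<^sub>v col T\<^sub>J\<^sub>I j" unfolding W_def using assms by (intro col_mult2[OF G_carrier blocks(3)])
  moreover have "0 \<le> (G *\<^sub>v col T\<^sub>J\<^sub>I j) $ i"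
    using blocks(3) assms c IJ(2)
    by (intro G_nonneg) (auto intro!: block_off_nonneg)
  ultimately show ?thesis using assms W_carrier by (metis carrier_matD index_col)
qed

lemma exit_vec_eq: "exit_vec T = - (T *\<^sub>v ones p)"
  unfolding exit_vec_def using T_carrier by simp

lemma exit_carrier: "exit_vec T \<in> carrier_vec p"
  unfolding exit_vec_eq using T_carrier by simp

lemma exit_nonneg: "i < p \<Longrightarrow> 0 \<le> exit_vec T $ i"
  unfolding exit_vec_eq using T T_carrier
  by (simp add: sub_intensity_matrix_def index_mult_mat_vec_sum)

text \<open>
  The \<open>J\<close> rows of the definition of the exit vector, solved for the constant vector on \<open>J\<close>. This is the
  form of \<open>g\<close> that shows its sign.
\<close>

lemma g_eq: "g = G *\<^sub>v subvec (exit_vec T) J"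
proof -
  have "subvec (T *\<^sub>v ones p) J = T\<^sub>J\<^sub>I *\<^sub>v ones (card I) + T\<^sub>J\<^sub>J *\<^sub>v ones (card J)"
    using subvec_mult_mat_vec[OF IJ T_carrier _ sub(2), of "ones p"] sub by (simp add: subvec_ones)
  moreover have "subvec (exit_vec T) J = - subvec (T *\<^sub>v ones p) J"
    using T_carrier sub unfolding exit_vec_eq
    by (intro eq_vecI) (auto simp: index_subvec[of _ p] pick_lt subvec_carrier[of _ p, THEN carrier_vecD])
  ultimately have t: "subvec (exit_vec T) J = - (T\<^sub>J\<^sub>I *\<^sub>v ones (card I) + T\<^sub>J\<^sub>J *\<^sub>v ones (card J))" by simp
  have c: "T\<^sub>J\<^sub>I *\<^sub>v ones (card I) \<in> carrier_vec (card J)" "T\<^sub>J\<^sub>J *\<^sub>v ones (card J) \<in> carrier_vec (card J)"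
    using blocks(3,4) by (meson mult_mat_vec_carrier ones_simps(1))+
  have "ones (card J) = G *\<^sub>v (T\<^sub>J\<^sub>I *\<^sub>v ones (card I) + subvec (exit_vec T) J)"
    unfolding t using c by (intro G_solve) auto
  also have "\<dots> = W *\<^sub>v ones (card I) + G *\<^sub>v subvec (exit_vec T) J"
    using c exit_carrier sub by (simp add: mult_add_distrib_mat_vec[OF G_carrier] W_mult)
  finally show ?thesis
    unfolding g_def by (intro eq_vecI) auto
qed

lemma g_nonneg: "i < card J \<Longrightarrow> 0 \<le> g $ i"
  unfolding g_eq using exit_carrier sub
  by (intro G_nonneg) (auto simp: index_subvec[of _ p] exit_nonneg pick_lt)

text \<open>
  The censored process exits directly from \<open>I\<close>, or through an excursion into \<open>J\<close> that ends in absorption.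
\<close>

lemma S_ones: "S *\<^sub>v ones (card I) = - (subvec (exit_vec T) I + T\<^sub>I\<^sub>J *\<^sub>v g)"
proof -
  have "subvec (T *\<^sub>v ones p) I = T\<^sub>I\<^sub>I *\<^sub>v ones (card I) + T\<^sub>I\<^sub>J *\<^sub>v ones (card J)"
    using subvec_mult_mat_vec[OF IJ T_carrier _ sub(1), of "ones p"] sub by (simp add: subvec_ones)
  moreover have "subvec (exit_vec T) I = - subvec (T *\<^sub>v ones p) I"
    using T_carrier sub unfolding exit_vec_eq
    by (intro eq_vecI) (auto simp: index_subvec[of _ p] pick_lt subvec_carrier[of _ p, THEN carrier_vecD])
  ultimately have t: "subvec (exit_vec T) I = - (T\<^sub>I\<^sub>I *\<^sub>v ones (card I) + T\<^sub>I\<^sub>J *\<^sub>v ones (card J))" by simp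
  have "T\<^sub>I\<^sub>J *\<^sub>v g = T\<^sub>I\<^sub>J *\<^sub>v ones (card J) - T\<^sub>I\<^sub>J *\<^sub>v (W *\<^sub>v ones (card I))"
    unfolding g_def
    by (intro mult_minus_distrib_mat_vec[OF blocks(2)] mult_mat_vec_carrier[OF W_carrier]) auto
  then show ?thesis
    unfolding t S_mult[OF ones_simps(1)] by (intro eq_vecI) auto
qed

lemma S_row_sum: "i < card I \<Longrightarrow> (S *\<^sub>v ones (card I)) $ i \<le> 0"
proof -
  assume i: "i < card I"
  have "0 \<le> (T\<^sub>I\<^sub>J *\<^sub>v g) $ i"
    using i IJ(2) by (intro mult_mat_vec_nonneg[OF blocks(2) g_carrier]) (auto intro: g_nonneg block_off_nonneg)
  moreover have "0 \<le> subvec (exit_vec T) I $ i"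
    using i sub exit_carrier by (simp add: index_subvec[of _ p] exit_nonneg pick_lt)
  ultimately show ?thesis using i sub exit_carrier by (simp add: S_ones)
qed

lemma S_off_nonneg:
  assumes "i < card I" "j < card I" "i \<noteq> j" shows "0 \<le> S $$ (i, j)"
proof -
  have "col (T\<^sub>I\<^sub>J * W) j = T\<^sub>I\<^sub>J *\<^sub>v col W j" using assms by (intro col_mult2[OF blocks(2) W_carrier])
  moreover have c: "col W j \<in> carrier_vec (card J)" by (rule carrier_vecI) simp
  have "0 \<le> (T\<^sub>I\<^sub>J *\<^sub>v col W j) $ i"
    using assms IJ(2)
    by (intro mult_mat_vec_nonneg[OF blocks(2) c]) (auto intro!: W_nonneg block_off_nonneg)
  ultimately have "0 \<le> (T\<^sub>I\<^sub>J * W) $$ (i, j)" using assms by (metis block_dims(2) dims(4) index_col index_mult_mat(2,3))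
  then show ?thesis unfolding S_eq using assms by (auto intro!: add_nonneg_nonneg block_off_nonneg)
qed

text \<open>
  For the positive \<open>z\<close> with \<open>T z < 0\<close>, the rows in \<open>J\<close> say that \<open>z\<close> on \<open>J\<close> is \<open>W z + G b\<close> with
  \<open>b \<ge> 0\<close>. Replacing \<open>z\<close> on \<open>J\<close> by the smaller \<open>W z\<close>, which is what \<open>S\<close> does, only decreases \<open>T z\<close>
  on \<open>I\<close>.
\<close>

lemma M_matrix_S: "M_matrix (card I) (- S)"
proof -
  obtain z where z: "z \<in> carrier_vec p" "\<And>i. i < p \<Longrightarrow> 0 < z $ i" "\<And>i. i < p \<Longrightarrow> (T *\<^sub>v z) $ i < 0"
    using strictly_superharmonic by blast
  define x where "x = subvec z I"
  define y where "y = subvec z J"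
  define b where "b = - subvec (T *\<^sub>v z) J"
  have Tz: "T *\<^sub>v z \<in> carrier_vec p" using T_carrier z(1) by simp
  have x: "x \<in> carrier_vec (card I)" and y: "y \<in> carrier_vec (card J)" and b: "b \<in> carrier_vec (card J)"
    using z(1) Tz sub by (auto simp: x_def y_def b_def)
  have b0: "0 \<le> b $ i" if "i < card J" for i
    using that z(3) Tz sub by (simp add: b_def index_subvec[of _ p] pick_lt less_imp_le subvec_carrier[of _ p, THEN carrier_vecD])
  have c: "T\<^sub>J\<^sub>I *\<^sub>v x \<in> carrier_vec (card J)" "W *\<^sub>v x \<in> carrier_vec (card J)" "G *\<^sub>v b \<in> carrier_vec (card J)"
    using mult_mat_vec_carrier[OF blocks(3) x] mult_mat_vec_carrier[OF W_carrier x] mult_mat_vec_carrier[OF G_carrier b] by auto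
  have bJ: "- b = T\<^sub>J\<^sub>I *\<^sub>v x + T\<^sub>J\<^sub>J *\<^sub>v y"
    unfolding b_def x_def y_def using subvec_mult_mat_vec[OF IJ T_carrier z(1) sub(2)] by simp
  have "T\<^sub>J\<^sub>J *\<^sub>v y = - (T\<^sub>J\<^sub>I *\<^sub>v x + b)"
  proof (rule eq_vecI)
    fix i assume "i < dim_vec (- (T\<^sub>J\<^sub>I *\<^sub>v x + b))"
    then have i: "i < card J" using b by simp
    show "(T\<^sub>J\<^sub>J *\<^sub>v y) $ i = (- (T\<^sub>J\<^sub>I *\<^sub>v x + b)) $ i"
      using arg_cong[OF bJ, of "\<lambda>v. v $ i"] i b by simp
  qed (use b in simp)
  then have "y = G *\<^sub>v (T\<^sub>J\<^sub>I *\<^sub>v x + b)" using c b y by (intro G_solve) auto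
  also have "\<dots> = W *\<^sub>v x + G *\<^sub>v b"
    using c b by (simp add: mult_add_distrib_mat_vec[OF G_carrier] W_mult[OF x])
  finally have yW: "y = W *\<^sub>v x + G *\<^sub>v b" .
  have "0 < ((- S) *\<^sub>v x) $ i" if i: "i < card I" for i
  proof -
    have "(S *\<^sub>v x) $ i + (T\<^sub>I\<^sub>J *\<^sub>v (G *\<^sub>v b)) $ i = (T\<^sub>I\<^sub>I *\<^sub>v x) $ i + (T\<^sub>I\<^sub>J *\<^sub>v y) $ i"
      using i unfolding yW S_mult[OF x] mult_add_distrib_mat_vec[OF blocks(2) c(2,3)] by simp
    also have "\<dots> = subvec (T *\<^sub>v z) I $ i"
      unfolding x_def y_def using subvec_mult_mat_vec[OF IJ T_carrier z(1) sub(1)] i by simp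
    also have "\<dots> < 0" using z(3) i sub Tz by (simp add: index_subvec[of _ p] pick_lt)
    finally have "(S *\<^sub>v x) $ i + (T\<^sub>I\<^sub>J *\<^sub>v (G *\<^sub>v b)) $ i < 0" .
    moreover have "0 \<le> (T\<^sub>I\<^sub>J *\<^sub>v (G *\<^sub>v b)) $ i"
      using i IJ(2) by (intro mult_mat_vec_nonneg[OF blocks(2) c(3)]) (auto intro!: block_off_nonneg G_nonneg b b0)
    ultimately show ?thesis using x i by simp
  qed
  moreover have "0 < x $ i" if "i < card I" for i
    using z sub that by (simp add: x_def index_subvec[of _ p] pick_lt)
  ultimately have pos: "\<exists>z\<in>carrier_vec (card I). \<forall>i<card I. 0 < z $ i \<and> 0 < ((- S) *\<^sub>v z) $ i"
    using x by blast
  show ?thesis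
    unfolding M_matrix_def
  proof (intro conjI)
    show "\<forall>i<card I. \<forall>j<card I. i \<noteq> j \<longrightarrow> (- S) $$ (i, j) \<le> 0" using S_off_nonneg by simp
  qed (use pos in simp_all)
qed

text \<open>
  If \<open>T x = - t\<close> on \<open>J\<close>, then \<open>x\<close> is determined on \<open>J\<close> by its values on \<open>I\<close>. The equation left on
  \<open>I\<close> involves the censored matrix, with the exit vector \<open>t\<close> replaced by \<open>- S 1\<close>.
\<close>

lemma eliminate:
  assumes x: "x \<in> carrier_vec p" and xJ: "\<forall>i\<in>J. (T *\<^sub>v x) $ i = - exit_vec T $ i"
  shows "subvec x J = g + W *\<^sub>v subvec x I"
    and "S *\<^sub>v subvec x I = subvec (T *\<^sub>v x) I + subvec (exit_vec T) I + S *\<^sub>v ones (card I)"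
proof -
  define a where "a = subvec x I"
  define t where "t = subvec (exit_vec T) J"
  have Tx: "T *\<^sub>v x \<in> carrier_vec p" using T_carrier x by simp
  have a: "a \<in> carrier_vec (card I)" and y: "subvec x J \<in> carrier_vec (card J)" and t: "t \<in> carrier_vec (card J)"
    using x exit_carrier sub by (auto simp: a_def t_def)
  have c: "T\<^sub>J\<^sub>I *\<^sub>v a \<in> carrier_vec (card J)" "W *\<^sub>v a \<in> carrier_vec (card J)"
    using mult_mat_vec_carrier[OF blocks(3) a] mult_mat_vec_carrier[OF W_carrier a] by auto
  have sp: "subvec (T *\<^sub>v x) J = T\<^sub>J\<^sub>I *\<^sub>v a + T\<^sub>J\<^sub>J *\<^sub>v subvec x J"
    unfolding a_def using subvec_mult_mat_vec[OF IJ T_carrier x sub(2)] .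
  have "T\<^sub>J\<^sub>J *\<^sub>v subvec x J = - (T\<^sub>J\<^sub>I *\<^sub>v a + t)"
  proof (rule eq_vecI)
    fix i assume "i < dim_vec (- (T\<^sub>J\<^sub>I *\<^sub>v a + t))"
    then have i: "i < card J" using t by simp
    have "subvec (T *\<^sub>v x) J $ i = - t $ i"
      using i Tx exit_carrier sub bspec[OF xJ pick_in_set_le[OF i]] by (simp add: t_def index_subvec[of _ p])
    then show "(T\<^sub>J\<^sub>J *\<^sub>v subvec x J) $ i = (- (T\<^sub>J\<^sub>I *\<^sub>v a + t)) $ i"
      using arg_cong[OF sp, of "\<lambda>v. v $ i"] i t by simp
  qed (use t in simp)
  then have "subvec x J = G *\<^sub>v (T\<^sub>J\<^sub>I *\<^sub>v a + t)" using c t y by (intro G_solve) auto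
  also have "\<dots> = G *\<^sub>v (T\<^sub>J\<^sub>I *\<^sub>v a) + G *\<^sub>v t" using c t by (intro mult_add_distrib_mat_vec[OF G_carrier])
  also have "\<dots> = W *\<^sub>v a + g" by (simp add: W_mult[OF a] g_eq t_def)
  also have "\<dots> = g + W *\<^sub>v a" using c by (intro comm_add_vec[of _ "card J"]) auto
  finally show 1: "subvec x J = g + W *\<^sub>v subvec x I" unfolding a_def .
  have "subvec (T *\<^sub>v x) I = T\<^sub>I\<^sub>I *\<^sub>v a + T\<^sub>I\<^sub>J *\<^sub>v (g + W *\<^sub>v a)"
    using subvec_mult_mat_vec[OF IJ T_carrier x sub(1)] by (simp add: 1 a_def)
  also have "\<dots> = T\<^sub>I\<^sub>I *\<^sub>v a + (T\<^sub>I\<^sub>J *\<^sub>v g + T\<^sub>I\<^sub>J *\<^sub>v (W *\<^sub>v a))"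
    using c by (simp add: mult_add_distrib_mat_vec[OF blocks(2)])
  finally show "S *\<^sub>v subvec x I = subvec (T *\<^sub>v x) I + subvec (exit_vec T) I + S *\<^sub>v ones (card I)"
    unfolding a_def[symmetric] S_ones S_mult[OF a]
    using subvec_carrier[OF exit_carrier sub(1)] by (intro eq_vecI) auto
qed

section \<open>Reduction of the resolvent\<close>

text \<open>
  Dividing row \<open>i\<close> by \<open>d $ i\<close> runs the censored process at speed \<open>1 / d $ i\<close> in state \<open>i\<close>.
\<close>

context
  fixes d :: "real Matrix.vec"
  assumes d: "d \<in> carrier_vec (card I)" "\<forall>i<card I. d $ i > 0"
begin

definition rescaled :: "real Matrix.mat" where "rescaled = mat_inv (diag_of d) * S"

lemma rescaled_carrier [simp]: "rescaled \<in> carrier_mat (card I) (card I)"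
  unfolding rescaled_def mat_inv_diag_of[OF d] by (rule mult_carrier_mat[OF mat_diag_dim S_carrier])

lemma index_rescaled: "i < card I \<Longrightarrow> j < card I \<Longrightarrow> rescaled $$ (i, j) = S $$ (i, j) / d $ i"
  unfolding rescaled_def mat_inv_diag_of[OF d] mat_diag_mult_left[OF S_carrier] by (simp add: divide_inverse)

lemma rescaled_mult: "x \<in> carrier_vec (card I) \<Longrightarrow> i < card I \<Longrightarrow> (rescaled *\<^sub>v x) $ i = (S *\<^sub>v x) $ i / d $ i"
  by (simp add: index_mult_mat_vec_sum[OF rescaled_carrier] index_mult_mat_vec_sum[OF S_carrier] index_rescaled sum_divide_distrib)

lemma M_matrix_rescaled: "M_matrix (card I) (- rescaled)"
proof -
  obtain z where z: "z \<in> carrier_vec (card I)" "\<And>i. i < card I \<Longrightarrow> 0 < z $ i"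
      "\<And>i. i < card I \<Longrightarrow> 0 < ((- S) *\<^sub>v z) $ i"
    using M_matrix_S unfolding M_matrix_def by blast
  have "0 < ((- rescaled) *\<^sub>v z) $ i" if i: "i < card I" for i
  proof -
    have "((- rescaled) *\<^sub>v z) $ i = ((- S) *\<^sub>v z) $ i / d $ i"
      using z(1) i carrier_matD[OF rescaled_carrier] rescaled_mult[OF z(1) i] by simp
    then show ?thesis using z(3)[OF i] d(2)[rule_format, OF i] by simp
  qed
  then have pos: "\<exists>z\<in>carrier_vec (card I). \<forall>i<card I. 0 < z $ i \<and> 0 < ((- rescaled) *\<^sub>v z) $ i"
    using z by blast
  show ?thesis
    unfolding M_matrix_def
  proof (intro conjI)
    show "\<forall>i<card I. \<forall>j<card I. i \<noteq> j \<longrightarrow> (- rescaled) $$ (i, j) \<le> 0"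
      using S_off_nonneg d(2) carrier_matD[OF rescaled_carrier] by (auto simp: index_rescaled intro!: divide_nonneg_pos)
  qed (use pos in simp_all)
qed

lemma sub_intensity_rescaled: "sub_intensity_matrix (card I) rescaled"
  unfolding sub_intensity_matrix_def
proof (intro conjI allI impI)
  show "invertible_mat rescaled" by (rule invertible_mat_of_M_matrix_uminus[OF M_matrix_rescaled rescaled_carrier])
  show "0 \<le> rescaled $$ (i, j)" if "i < card I" "j < card I" "i \<noteq> j" for i j
    using that S_off_nonneg d(2) by (simp add: index_rescaled divide_nonneg_pos)
  show "(\<Sum>j<card I. rescaled $$ (i, j)) \<le> 0" if i: "i < card I" for i
  proof -
    have "(\<Sum>j<card I. rescaled $$ (i, j)) = (rescaled *\<^sub>v ones (card I)) $ i"
      using i by (simp add: index_mult_mat_vec_sum[OF rescaled_carrier])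
    also have "\<dots> = (S *\<^sub>v ones (card I)) $ i / d $ i" using i by (simp add: rescaled_mult)
    finally show ?thesis using S_row_sum[OF i] d(2)[rule_format, OF i] by (simp add: divide_nonpos_pos)
  qed
qed simp

end

end

lemma M_matrix_shift:
  assumes "M_matrix k (- A)" "A \<in> carrier_mat k k" "v \<ge> 0"
  shows "M_matrix k (v \<cdot>\<^sub>m 1\<^sub>m k - A)"
  by (rule M_matrix_increase_diagonal[OF assms(1)]) (use assms(2,3) in \<open>auto intro: minus_carrier_mat\<close>)

lemma shift_mult:
  fixes A :: "real Matrix.mat"
  assumes "A \<in> carrier_mat k k" "x \<in> carrier_vec k" "i < k"
  shows "((v \<cdot>\<^sub>m 1\<^sub>m k - A) *\<^sub>v x) $ i = v * x $ i - (A *\<^sub>v x) $ i"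
proof -
  have "(v \<cdot>\<^sub>m 1\<^sub>m k - A) *\<^sub>v x = (v \<cdot>\<^sub>m 1\<^sub>m k) *\<^sub>v x - A *\<^sub>v x"
    using assms by (intro minus_mult_distrib_mat_vec) auto
  moreover have "((v \<cdot>\<^sub>m 1\<^sub>m k) *\<^sub>v x) $ i = v * x $ i"
    using assms by (simp add: index_mult_mat_vec_sum[of _ k k] if_distrib[of "\<lambda>a. _ * a * _"] if_distrib[of "\<lambda>a. a * _"] cong: if_cong)
  ultimately show ?thesis using assms by simp
qed

lemma diag_minus_mult:
  fixes A :: "real Matrix.mat"
  assumes "A \<in> carrier_mat k k" "x \<in> carrier_vec k" "\<rho> \<in> carrier_vec k" "i < k"
  shows "((diag_of \<rho> - A) *\<^sub>v x) $ i = \<rho> $ i * x $ i - (A *\<^sub>v x) $ i"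
proof -
  have D: "diag_of \<rho> \<in> carrier_mat k k" using assms by (simp add: diag_of_def)
  have "(diag_of \<rho> - A) *\<^sub>v x = diag_of \<rho> *\<^sub>v x - A *\<^sub>v x"
    using assms D by (intro minus_mult_distrib_mat_vec) auto
  moreover have "(diag_of \<rho> *\<^sub>v x) $ i = \<rho> $ i * x $ i"
    using assms by (simp add: index_mult_mat_vec_sum[OF D]) (simp add: diag_of_def mat_diag_def if_distrib[of "\<lambda>a. a * _"] cong: if_cong)
  ultimately show ?thesis using assms by simp
qed

text \<open>
  The rows of the system in \<open>J\<close> are free of \<open>v\<close> because \<open>\<rho>\<close> vanishes there, so \<open>eliminate\<close> applies
  with matrices that do not depend on \<open>v\<close>. The rows in \<open>I\<close> become the resolvent equation of the
  rescaled censored matrix after division by \<open>\<rho>\<close>.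
\<close>

lemma (in censored_sub_intensity) resolvent_reduction:
  assumes \<rho>: "\<rho> \<in> carrier_vec p" "\<And>i. i \<in> I \<Longrightarrow> 0 < \<rho> $ i" "\<And>i. i \<in> J \<Longrightarrow> \<rho> $ i = 0"
    and v: "v \<ge> 0" and \<pi>: "\<pi> \<in> carrier_vec p"
  defines "A \<equiv> mat_inv (diag_of (subvec \<rho> I)) * S"
  shows "\<pi> \<bullet> (mat_inv (diag_of (v \<cdot>\<^sub>v \<rho>) - T) *\<^sub>v exit_vec T) =
    subvec \<pi> J \<bullet> g + (subvec \<pi> I + W\<^sup>T *\<^sub>v subvec \<pi> J) \<bullet> (mat_inv (v \<cdot>\<^sub>m 1\<^sub>m (card I) - A) *\<^sub>v exit_vec A)"
proof -
  define d where "d = subvec \<rho> I"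
  have d: "d \<in> carrier_vec (card I)" "\<forall>i<card I. d $ i > 0"
    using \<rho> sub pick_in_set_le by (auto simp: d_def index_subvec[of _ p])
  have A: "rescaled d = A" unfolding A_def d_def[symmetric] by (rule rescaled_def[OF d])
  note Ac = rescaled_carrier[OF d, unfolded A] and AM = M_matrix_rescaled[OF d, unfolded A]
    and Am = rescaled_mult[OF d, unfolded A]
  have v\<rho>: "v \<cdot>\<^sub>v \<rho> \<in> carrier_vec p" using \<rho> by simp
  have \<rho>0: "0 \<le> \<rho> $ i" if "i < p" for i
  proof -
    have "i \<in> I \<or> i \<in> J" using that IJ(1) by (metis UnE lessThan_iff)
    then show ?thesis using \<rho>(2,3) by (metis less_imp_le order_refl)
  qed
  have BM: "M_matrix p (diag_of (v \<cdot>\<^sub>v \<rho>) - T)"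
    by (rule M_matrix_increase_diagonal[OF sub_intensity_imp_M_matrix[OF T]])
      (use T_carrier \<rho> v \<rho>0 in \<open>auto simp: diag_of_def mat_diag_def intro: minus_carrier_mat\<close>)
  define x where "x = mat_inv (diag_of (v \<cdot>\<^sub>v \<rho>) - T) *\<^sub>v exit_vec T"
  note x = M_matrix_solve[OF BM exit_carrier, folded x_def]
  have Tx: "T *\<^sub>v x \<in> carrier_vec p" using T_carrier x by simp
  have eq: "(T *\<^sub>v x) $ i = v * \<rho> $ i * x $ i - exit_vec T $ i" if "i < p" for i
    using diag_minus_mult[OF T_carrier x(1) v\<rho> that] x(2) that \<rho> by simp
  have J: "\<forall>i\<in>J. (T *\<^sub>v x) $ i = - exit_vec T $ i"
    using eq \<rho>(3) sub by auto
  note el = eliminate[OF x(1) J]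
  define a where "a = subvec x I"
  have a: "a \<in> carrier_vec (card I)" using x sub by (simp add: a_def)
  have "(v \<cdot>\<^sub>m 1\<^sub>m (card I) - A) *\<^sub>v a = exit_vec A"
  proof (rule eq_vecI)
    fix i assume "i < dim_vec (exit_vec A)"
    then have i: "i < card I" using Ac by (simp add: exit_vec_def)
    have ip: "pick I i < p" "pick I i \<in> I" using i sub pick_lt pick_in_set_le by auto
    have t: "subvec (exit_vec T) I \<in> carrier_vec (card I)" using exit_carrier sub by simp
    have "(S *\<^sub>v a) $ i = (subvec (T *\<^sub>v x) I $ i + subvec (exit_vec T) I $ i) + (S *\<^sub>v ones (card I)) $ i"
      unfolding a_def el(2) using i carrier_vecD[OF t] by simp
    also have "subvec (T *\<^sub>v x) I $ i + subvec (exit_vec T) I $ i = v * d $ i * a $ i"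
      unfolding a_def d_def index_subvec[OF Tx sub(1) i] index_subvec[OF exit_carrier sub(1) i]
        index_subvec[OF x(1) sub(1) i] index_subvec[OF \<rho>(1) sub(1) i] eq[OF ip(1)] by simp
    finally have "(S *\<^sub>v a) $ i = v * d $ i * a $ i + (S *\<^sub>v ones (card I)) $ i" .
    then have "(A *\<^sub>v a) $ i = v * a $ i + (A *\<^sub>v ones (card I)) $ i"
      using d(2)[rule_format, OF i] i a by (simp add: Am add_divide_distrib)
    moreover have "exit_vec A $ i = - (A *\<^sub>v ones (card I)) $ i"
      using Ac i by (simp add: exit_vec_def)
    ultimately show "((v \<cdot>\<^sub>m 1\<^sub>m (card I) - A) *\<^sub>v a) $ i = exit_vec A $ i"
      using shift_mult[OF Ac a i] by simp
  qed (use Ac in \<open>simp add: exit_vec_def\<close>)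
  then have a_eq: "a = mat_inv (v \<cdot>\<^sub>m 1\<^sub>m (card I) - A) *\<^sub>v exit_vec A"
    by (rule M_matrix_solution_unique[OF M_matrix_shift[OF AM Ac v] a])
  have \<pi>J: "subvec \<pi> J \<in> carrier_vec (card J)" and \<pi>I: "subvec \<pi> I \<in> carrier_vec (card I)" using \<pi> sub by auto
  have Wa: "W *\<^sub>v a \<in> carrier_vec (card J)" by (rule mult_mat_vec_carrier[OF W_carrier a])
  have Wt: "W\<^sup>T *\<^sub>v subvec \<pi> J \<in> carrier_vec (card I)" using \<pi>J by (intro mult_mat_vec_carrier[of _ _ "card J"]) auto
  have "\<pi> \<bullet> x = subvec \<pi> I \<bullet> a + subvec \<pi> J \<bullet> (g + W *\<^sub>v a)"
    unfolding scalar_prod_split[OF IJ x(1) \<pi>] el(1) a_def ..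
  also have "subvec \<pi> J \<bullet> (g + W *\<^sub>v a) = subvec \<pi> J \<bullet> g + subvec \<pi> J \<bullet> (W *\<^sub>v a)"
    by (rule scalar_prod_add_distrib[OF \<pi>J g_carrier Wa])
  also have "subvec \<pi> J \<bullet> (W *\<^sub>v a) = (W\<^sup>T *\<^sub>v subvec \<pi> J) \<bullet> a"
    by (rule transpose_vec_mult_scalar[OF W_carrier a \<pi>J, symmetric])
  also have "subvec \<pi> I \<bullet> a + (subvec \<pi> J \<bullet> g + (W\<^sup>T *\<^sub>v subvec \<pi> J) \<bullet> a) =
      subvec \<pi> J \<bullet> g + (subvec \<pi> I + W\<^sup>T *\<^sub>v subvec \<pi> J) \<bullet> a"
    using add_scalar_prod_distrib[OF \<pi>I Wt a] by simp
  finally show ?thesis unfolding x_def a_eq .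
qed

section \<open>Expansion of the resolvent\<close>

definition mat_orbit :: "real Matrix.mat \<Rightarrow> real Matrix.vec \<Rightarrow> nat \<Rightarrow> real Matrix.vec" where
  "mat_orbit A s n = ((\<lambda>x. A *\<^sub>v x) ^^ n) s"

lemma mat_orbit_simps: "mat_orbit A s 0 = s" "mat_orbit A s (Suc n) = A *\<^sub>v mat_orbit A s n"
  by (simp_all add: mat_orbit_def)

context
  fixes A :: "real Matrix.mat" and s :: "real Matrix.vec" and k :: nat
  assumes A: "A \<in> carrier_mat k k" and s: "s \<in> carrier_vec k"
begin

lemma mat_orbit_carrier: "mat_orbit A s n \<in> carrier_vec k"
  using A s by (induction n) (simp_all add: mat_orbit_simps)

lemma mat_orbit_bound:
  "(\<Sum>i<k. \<bar>mat_orbit A s n $ i\<bar>) \<le> (\<Sum>i<k. \<bar>s $ i\<bar>) * (\<Sum>i<k. \<Sum>j<k. \<bar>A $$ (i, j)\<bar>) ^ n"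
proof (induction n)
  case (Suc n)
  have "(\<Sum>i<k. \<bar>mat_orbit A s (Suc n) $ i\<bar>) \<le>
      (\<Sum>i<k. \<Sum>j<k. \<bar>A $$ (i, j)\<bar>) * (\<Sum>i<k. \<bar>mat_orbit A s n $ i\<bar>)"
    unfolding mat_orbit_simps by (rule sum_abs_mult_mat_vec_le[OF A mat_orbit_carrier])
  also have "\<dots> \<le> (\<Sum>i<k. \<Sum>j<k. \<bar>A $$ (i, j)\<bar>) * ((\<Sum>i<k. \<bar>s $ i\<bar>) * (\<Sum>i<k. \<Sum>j<k. \<bar>A $$ (i, j)\<bar>) ^ n)"
    using Suc by (intro mult_left_mono) (auto intro!: sum_nonneg)
  finally show ?case by (simp add: ac_simps)
qed (simp add: mat_orbit_simps)

text \<open>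
  The Neumann series \<open>\<Sum>n. v\<^sup>-\<^sup>n\<^sup>-\<^sup>1 A\<^sup>n s\<close>, summed entry by entry; it converges because the sum of the
  absolute values of all entries bounds the operator norm with respect to the 1-norm.
\<close>

lemma resolvent_series:
  assumes v: "v > (\<Sum>i<k. \<Sum>j<k. \<bar>A $$ (i, j)\<bar>)"
  defines "x \<equiv> Matrix.vec k (\<lambda>i. \<Sum>n. mat_orbit A s n $ i * inverse v ^ Suc n)"
  shows "(v \<cdot>\<^sub>m 1\<^sub>m k - A) *\<^sub>v x = s"
    and "b \<in> carrier_vec k \<Longrightarrow> b \<bullet> x = (\<Sum>n. (b \<bullet> mat_orbit A s n) * inverse v ^ Suc n)"
proof -
  define C where "C = (\<Sum>i<k. \<Sum>j<k. \<bar>A $$ (i, j)\<bar>)"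
  define N where "N = (\<Sum>i<k. \<bar>s $ i\<bar>)"
  have C0: "C \<ge> 0" by (auto simp: C_def intro!: sum_nonneg)
  have v0: "v > 0" and Cv: "C < v" using v C0 by (auto simp: C_def)
  have y: "C * inverse v < 1" using v0 Cv by (simp add: field_simps)
  have sm: "summable (\<lambda>n. mat_orbit A s n $ i * inverse v ^ Suc n)" if "i < k" for i
  proof (rule summable_comparison_test')
    show "summable (\<lambda>n. N * inverse v * (C * inverse v) ^ n)"
      using y v0 C0 by (intro summable_mult summable_geometric) auto
    fix n assume "n \<ge> (0::nat)"
    have "\<bar>mat_orbit A s n $ i\<bar> \<le> (\<Sum>i<k. \<bar>mat_orbit A s n $ i\<bar>)"
      using that by (intro member_le_sum) auto
    also have "\<dots> \<le> N * C ^ n" unfolding N_def C_def by (rule mat_orbit_bound)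
    finally have "\<bar>mat_orbit A s n $ i\<bar> * inverse v ^ Suc n \<le> N * C ^ n * inverse v ^ Suc n"
      using v0 by (intro mult_right_mono) auto
    then show "norm (mat_orbit A s n $ i * inverse v ^ Suc n) \<le> N * inverse v * (C * inverse v) ^ n"
      using v0 by (simp add: abs_mult power_mult_distrib ac_simps)
  qed
  have xc: "x \<in> carrier_vec k" by (simp add: x_def)
  show "(v \<cdot>\<^sub>m 1\<^sub>m k - A) *\<^sub>v x = s"
  proof (rule eq_vecI)
    fix i assume "i < dim_vec s"
    then have i: "i < k" using s by simp
    have "(A *\<^sub>v x) $ i = (\<Sum>j<k. \<Sum>n. A $$ (i, j) * (mat_orbit A s n $ j * inverse v ^ Suc n))"
      unfolding index_mult_mat_vec_sum[OF A xc i]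
      by (intro sum.cong refl) (simp add: x_def suminf_mult[OF sm, symmetric] del: power_Suc)
    also have "\<dots> = (\<Sum>n. \<Sum>j<k. A $$ (i, j) * (mat_orbit A s n $ j * inverse v ^ Suc n))"
      by (intro suminf_sum[symmetric] summable_mult sm) auto
    also have "\<dots> = (\<Sum>n. mat_orbit A s (Suc n) $ i * inverse v ^ Suc n)"
      unfolding mat_orbit_simps index_mult_mat_vec_sum[OF A mat_orbit_carrier i]
      by (simp add: sum_distrib_right mult.assoc)
    finally have Ax: "(A *\<^sub>v x) $ i = (\<Sum>n. mat_orbit A s (Suc n) $ i * inverse v ^ Suc n)" .
    have "v * x $ i = (\<Sum>n. v * (mat_orbit A s n $ i * inverse v ^ Suc n))"
      using i by (simp add: x_def suminf_mult[OF sm[OF i]] del: power_Suc)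
    also have "\<dots> = (\<Sum>n. mat_orbit A s n $ i * inverse v ^ n)"
      using v0 by (intro suminf_cong) simp
    also have "\<dots> = s $ i + (\<Sum>n. mat_orbit A s (Suc n) $ i * inverse v ^ Suc n)"
    proof -
      have "summable (\<lambda>n. v * (mat_orbit A s n $ i * inverse v ^ Suc n))"
        by (rule summable_mult[OF sm[OF i]])
      then have "summable (\<lambda>n. mat_orbit A s n $ i * inverse v ^ n)"
        using v0 by (simp add: field_simps)
      then show ?thesis using suminf_split_head[of "\<lambda>n. mat_orbit A s n $ i * inverse v ^ n"]
        by (simp add: mat_orbit_simps(1))
    qed
    finally show "((v \<cdot>\<^sub>m 1\<^sub>m k - A) *\<^sub>v x) $ i = s $ i"
      unfolding shift_mult[OF A xc i] Ax by simp
  qed (use A s in simp)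
  show "b \<bullet> x = (\<Sum>n. (b \<bullet> mat_orbit A s n) * inverse v ^ Suc n)" if b: "b \<in> carrier_vec k"
  proof -
    have "b \<bullet> x = (\<Sum>i<k. \<Sum>n. b $ i * (mat_orbit A s n $ i * inverse v ^ Suc n))"
      unfolding scalar_prod_eq_sum[OF xc]
      by (intro sum.cong refl) (simp add: x_def suminf_mult[OF sm, symmetric] del: power_Suc)
    also have "\<dots> = (\<Sum>n. \<Sum>i<k. b $ i * (mat_orbit A s n $ i * inverse v ^ Suc n))"
      by (intro suminf_sum[symmetric] summable_mult sm) auto
    finally show ?thesis
      unfolding scalar_prod_eq_sum[OF mat_orbit_carrier] by (simp add: sum_distrib_right mult.assoc)
  qed
qed

end

lemma mml_transform_expansion:
  assumes A: "A \<in> carrier_mat k k" "M_matrix k (- A)" and b: "b \<in> carrier_vec k"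
  shows "\<exists>c B C. C > 0 \<and> (\<forall>n. \<bar>c n\<bar> \<le> B * C ^ n) \<and>
    (\<forall>u. u powr \<alpha> > C \<longrightarrow> mml_transform \<alpha> b A u = (\<Sum>n. c n * inverse (u powr \<alpha>) ^ Suc n))"
proof -
  define s where "s = exit_vec A"
  have s: "s \<in> carrier_vec k" unfolding s_def exit_vec_def using A by (auto intro!: mult_mat_vec_carrier)
  define C0 where "C0 = (\<Sum>i<k. \<Sum>j<k. \<bar>A $$ (i, j)\<bar>)"
  define N where "N = (\<Sum>i<k. \<bar>s $ i\<bar>)"
  have C0: "C0 \<ge> 0" and N0: "N \<ge> 0" by (auto simp: C0_def N_def intro!: sum_nonneg)
  have pos: "C0 + 1 > 0" using C0 by simp
  have bound: "\<bar>b \<bullet> mat_orbit A s n\<bar> \<le> (\<Sum>i<k. \<bar>b $ i\<bar>) * N * (C0 + 1) ^ n" for n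
  proof -
    have "\<bar>b \<bullet> mat_orbit A s n\<bar> \<le> (\<Sum>i<k. \<bar>b $ i\<bar> * \<bar>mat_orbit A s n $ i\<bar>)"
      unfolding scalar_prod_eq_sum[OF mat_orbit_carrier[OF A(1) s]] abs_mult[symmetric] by (rule sum_abs)
    also have "\<dots> \<le> (\<Sum>i<k. \<bar>b $ i\<bar> * (N * (C0 + 1) ^ n))"
    proof (intro sum_mono mult_left_mono)
      fix i assume i: "i \<in> {..<k}"
      have "\<bar>mat_orbit A s n $ i\<bar> \<le> (\<Sum>i<k. \<bar>mat_orbit A s n $ i\<bar>)" using i by (intro member_le_sum) auto
      also have "\<dots> \<le> N * C0 ^ n" unfolding N_def C0_def by (rule mat_orbit_bound[OF A(1) s])
      also have "\<dots> \<le> N * (C0 + 1) ^ n" using C0 N0 by (intro mult_left_mono power_mono) auto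
      finally show "\<bar>mat_orbit A s n $ i\<bar> \<le> N * (C0 + 1) ^ n" .
    qed simp
    also have "\<dots> = (\<Sum>i<k. \<bar>b $ i\<bar>) * N * (C0 + 1) ^ n" by (simp add: sum_distrib_right mult.assoc)
    finally show ?thesis .
  qed
  have expansion: "mml_transform \<alpha> b A u = (\<Sum>n. (b \<bullet> mat_orbit A s n) * inverse (u powr \<alpha>) ^ Suc n)"
    if u: "u powr \<alpha> > C0 + 1" for u
  proof -
    have v: "u powr \<alpha> > (\<Sum>i<k. \<Sum>j<k. \<bar>A $$ (i, j)\<bar>)" using u by (simp add: C0_def)
    note r = resolvent_series[OF A(1) s v]
    have "u powr \<alpha> \<ge> 0" by simp
    note sol = M_matrix_solution_unique[OF M_matrix_shift[OF A(2,1) this] _ r(1)]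
    show ?thesis
      unfolding mml_transform_def r(2)[OF b, symmetric] using A by (subst sol) (auto simp: s_def)
  qed
  show ?thesis
    by (intro exI[of _ "\<lambda>n. b \<bullet> mat_orbit A s n"] exI[of _ "(\<Sum>i<k. \<bar>b $ i\<bar>) * N"] exI[of _ "C0 + 1"]
        conjI allI impI pos bound expansion)
qed

section \<open>The law of a nonnegative linear combination\<close>

theorem theorem4:
  fixes \<alpha> :: real and p n :: nat
    and \<pi> :: "real Matrix.vec" and T R :: "real Matrix.mat"
    and M :: "'a measure" and X :: "nat \<Rightarrow> 'a \<Rightarrow> real"
    and w :: "real Matrix.vec"
  assumes alpha: "0 < \<alpha>" "\<alpha> \<le> 1"
    and rep: "phase_type_rep p \<pi> T"
    and R: "R \<in> carrier_mat p n" "\<forall>i<p. \<forall>j<n. 0 \<le> R $$ (i, j)"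
    and M: "prob_space M"
    and X: "\<forall>j<n. X j \<in> borel_measurable M" "\<forall>j<n. \<forall>\<omega>\<in>space M. 0 \<le> X j \<omega>"
    and laplace: "\<forall>u\<in>carrier_vec n. (\<forall>j<n. 0 \<le> u $ j) \<longrightarrow>
      prob_space.expectation M (\<lambda>\<omega>. exp (- (\<Sum>j<n. u $ j * X j \<omega>))) =
        \<pi> \<bullet> (mat_inv (diag_of (R *\<^sub>v vec_powr u \<alpha>) - T) *\<^sub>v exit_vec T)"
    and w: "w \<in> carrier_vec n" "\<forall>j<n. 0 \<le> w $ j" "w \<noteq> 0\<^sub>v n"
  defines "r \<equiv> R *\<^sub>v vec_powr w \<alpha>"
  defines "Ep \<equiv> {i. i < p \<and> 0 < r $ i}"
    and "Ez \<equiv> {i. i < p \<and> r $ i = 0}"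
  defines "\<pi>p \<equiv> subvec \<pi> Ep" and "\<pi>z \<equiv> subvec \<pi> Ez"
    and "Tpp \<equiv> submatrix T Ep Ep" and "Tpz \<equiv> submatrix T Ep Ez"
    and "Tzp \<equiv> submatrix T Ez Ep" and "Tzz \<equiv> submatrix T Ez Ez"
  defines "q \<equiv> \<pi>z \<bullet> (ones (card Ez) - (mat_inv (- Tzz) * Tzp) *\<^sub>v ones (card Ep))"
    and "\<pi>w \<equiv> \<pi>p + (mat_inv (- Tzz) * Tzp)\<^sup>T *\<^sub>v \<pi>z"
    and "Tw \<equiv> mat_inv (diag_of (subvec r Ep)) * (Tpp + Tpz * mat_inv (- Tzz) * Tzp)"
    and "law \<equiv> distr M borel (\<lambda>\<omega>. \<Sum>j<n. X j \<omega> * w $ j)"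
  shows "measure law {0} = q \<and>
    (\<exists>\<nu>. defective_MML \<alpha> \<pi>w Tw \<nu> \<and>
         emeasure \<nu> {..0} = 0 \<and> absolutely_continuous lborel \<nu> \<and>
         (\<forall>A\<in>sets borel.
            emeasure law A = ennreal q * emeasure (return borel 0) A + emeasure \<nu> A))"
proof -
  interpret prob_space M by fact
  have \<pi>: "\<pi> \<in> carrier_vec p" "\<And>i. i < p \<Longrightarrow> 0 \<le> \<pi> $ i" "(\<Sum>i<p. \<pi> $ i) = 1"
    and T: "sub_intensity_matrix p T"
    using rep by (auto simp: phase_type_rep_def)
  have wa: "vec_powr w \<alpha> \<in> carrier_vec n" using w(1) by (simp add: vec_powr_def)
  have r: "r \<in> carrier_vec p" unfolding r_def using R(1) wa by simp
  have r0: "0 \<le> r $ i" if "i < p" for i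
    unfolding r_def index_mult_mat_vec_sum[OF R(1) wa that]
    using that R(2) w(1) by (auto intro!: sum_nonneg mult_nonneg_nonneg simp: vec_powr_def)
  \<comment> \<open>Since \<open>r \<ge> 0\<close>, every state belongs to exactly one of the two sets.\<close>
  have split: "Ep \<union> Ez = {..<p}" "Ep \<inter> Ez = {}"
    using r0 by (auto simp: Ep_def Ez_def order_le_less)
  interpret censored_sub_intensity p T Ep Ez by unfold_locales (fact T split)+
  have q_eq: "q = \<pi>z \<bullet> g" and \<pi>w_eq: "\<pi>w = \<pi>p + W\<^sup>T *\<^sub>v \<pi>z"
    and Tw_eq: "Tw = mat_inv (diag_of (subvec r Ep)) * S"
    by (simp_all add: q_def \<pi>w_def Tw_def g_def W_def G_def S_def Tpp_def Tpz_def Tzp_def Tzz_def)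
  have d: "subvec r Ep \<in> carrier_vec (card Ep)" "\<forall>i<card Ep. 0 < subvec r Ep $ i"
    using r sub pick_in_set_le by (auto simp: index_subvec[of _ p] Ep_def)
  note Tw_rescaled = rescaled_def[OF d, folded Tw_eq]
  note Twc = rescaled_carrier[OF d, unfolded Tw_rescaled] and TwM = M_matrix_rescaled[OF d, unfolded Tw_rescaled]
    and Tw_sub = sub_intensity_rescaled[OF d, unfolded Tw_rescaled]
  have \<pi>pc: "\<pi>p \<in> carrier_vec (card Ep)" and \<pi>zc: "\<pi>z \<in> carrier_vec (card Ez)"
    unfolding \<pi>p_def \<pi>z_def using \<pi>(1) sub by auto
  have \<pi>p0: "0 \<le> \<pi>p $ i" if "i < card Ep" for i
    unfolding \<pi>p_def using that \<pi> sub by (simp add: index_subvec[of _ p] pick_lt)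
  have \<pi>z0: "0 \<le> \<pi>z $ i" if "i < card Ez" for i
    unfolding \<pi>z_def using that \<pi> sub by (simp add: index_subvec[of _ p] pick_lt)
  have Wt: "W\<^sup>T \<in> carrier_mat (card Ep) (card Ez)" by simp
  have Wtz: "W\<^sup>T *\<^sub>v \<pi>z \<in> carrier_vec (card Ep)" by (rule mult_mat_vec_carrier[OF Wt \<pi>zc])
  have \<pi>wc: "\<pi>w \<in> carrier_vec (card Ep)" unfolding \<pi>w_eq using \<pi>pc Wtz by simp
  have q0: "0 \<le> q"
    unfolding q_eq scalar_prod_eq_sum[OF g_carrier] using \<pi>z0 g_nonneg by (intro sum_nonneg) auto
  have \<pi>w0: "0 \<le> \<pi>w $ i" if i: "i < card Ep" for i
  proof -
    have "0 \<le> (W\<^sup>T *\<^sub>v \<pi>z) $ i"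
      using i by (intro mult_mat_vec_nonneg[OF Wt \<pi>zc]) (auto intro: W_nonneg \<pi>z0)
    then show ?thesis unfolding \<pi>w_eq using \<pi>p0[OF i] i Wtz by simp
  qed
  \<comment> \<open>The mass missing from \<open>\<pi>w\<close> is the atom: \<open>\<pi>\<close> has total mass 1, and \<open>W 1 = 1 - g\<close>.\<close>
  have \<pi>w1: "(\<Sum>i<card Ep. \<pi>w $ i) = 1 - q"
  proof -
    have e: "ones k \<in> carrier_vec k" for k by simp
    have We: "W *\<^sub>v ones (card Ep) \<in> carrier_vec (card Ez)" by (rule mult_mat_vec_carrier[OF W_carrier e])
    have "1 = \<pi> \<bullet> ones p" using \<pi>(3) by (simp add: scalar_prod_eq_sum[OF e])
    also have "\<dots> = \<pi>p \<bullet> ones (card Ep) + \<pi>z \<bullet> ones (card Ez)"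
      unfolding scalar_prod_split[OF split e \<pi>(1)] \<pi>p_def \<pi>z_def subvec_ones[OF sub(1)] subvec_ones[OF sub(2)] ..
    finally have 1: "1 = \<pi>p \<bullet> ones (card Ep) + \<pi>z \<bullet> ones (card Ez)" .
    have "(\<Sum>i<card Ep. \<pi>w $ i) = \<pi>w \<bullet> ones (card Ep)" by (simp add: scalar_prod_eq_sum[OF e])
    also have "\<dots> = \<pi>p \<bullet> ones (card Ep) + \<pi>z \<bullet> (W *\<^sub>v ones (card Ep))"
      unfolding \<pi>w_eq add_scalar_prod_distrib[OF \<pi>pc Wtz e] transpose_vec_mult_scalar[OF W_carrier e \<pi>zc] ..
    also have "\<pi>z \<bullet> (W *\<^sub>v ones (card Ep)) = \<pi>z \<bullet> ones (card Ez) - q"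
      unfolding q_eq g_def scalar_prod_minus_distrib[OF \<pi>zc e We] by simp
    finally show ?thesis using 1 by simp
  qed

  define Y where "Y = (\<lambda>\<omega>. \<Sum>j<n. X j \<omega> * w $ j)"
  have Ym [measurable]: "Y \<in> borel_measurable M"
    unfolding Y_def using X(1) by (intro borel_measurable_sum borel_measurable_times) auto
  have Y0: "0 \<le> Y \<omega>" if "\<omega> \<in> space M" for \<omega>
    unfolding Y_def using X(2) w(2) that by (auto intro!: sum_nonneg)
  have law: "law = distr M borel Y" by (simp add: law_def Y_def)
  interpret law: prob_space law unfolding law by (rule prob_space_distr) simp
  have law_sets [measurable_cong]: "sets law = sets borel" by (simp add: law)
  have law_neg: "emeasure law {..<0} = 0"
  proof -
    have "\<not> Y \<omega> < 0" if "\<omega> \<in> space M" for \<omega> using Y0[OF that] by simp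
    then have "Y -` {..<0} \<inter> space M = {}" by auto
    then show ?thesis by (simp add: law emeasure_distr)
  qed
  have law_AE: "AE x in law. 0 \<le> x" by (rule AE_I[of _ _ "{..<0}"]) (use law_neg law_sets in auto)
  \<comment> \<open>The joint transform at \<open>u w\<close>, using \<open>(u w)\<^sup>\<alpha> = u\<^sup>\<alpha> w\<^sup>\<alpha>\<close>.\<close>
  have transform: "(LINT x|law. exp (- (u * x))) = q + mml_transform \<alpha> \<pi>w Tw u" if u: "0 \<le> u" for u
  proof -
    have uw: "u \<cdot>\<^sub>v w \<in> carrier_vec n" "\<forall>j<n. 0 \<le> (u \<cdot>\<^sub>v w) $ j" using w u by auto
    have "vec_powr (u \<cdot>\<^sub>v w) \<alpha> = u powr \<alpha> \<cdot>\<^sub>v vec_powr w \<alpha>"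
      using w u by (intro eq_vecI) (auto simp: vec_powr_def powr_mult)
    then have Rr: "R *\<^sub>v vec_powr (u \<cdot>\<^sub>v w) \<alpha> = u powr \<alpha> \<cdot>\<^sub>v r"
      unfolding r_def using R(1) wa by (simp add: mult_mat_vec)
    have "(LINT x|law. exp (- (u * x))) = expectation (\<lambda>\<omega>. exp (- (u * Y \<omega>)))"
      by (simp add: law integral_distr)
    also have "\<dots> = expectation (\<lambda>\<omega>. exp (- (\<Sum>j<n. (u \<cdot>\<^sub>v w) $ j * X j \<omega>)))"
    proof -
      have "u * Y \<omega> = (\<Sum>j<n. (u \<cdot>\<^sub>v w) $ j * X j \<omega>)" for \<omega>
        unfolding Y_def sum_distrib_left using w(1) by (intro sum.cong) auto
      then show ?thesis by simp
    qed
    also have "\<dots> = \<pi> \<bullet> (mat_inv (diag_of (u powr \<alpha> \<cdot>\<^sub>v r) - T) *\<^sub>v exit_vec T)"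
      using bspec[OF laplace uw(1)] uw(2) unfolding Rr by blast
    also have "\<dots> = q + \<pi>w \<bullet> (mat_inv (u powr \<alpha> \<cdot>\<^sub>m 1\<^sub>m (card Ep) - Tw) *\<^sub>v exit_vec Tw)"
      unfolding q_eq \<pi>w_eq Tw_eq \<pi>p_def \<pi>z_def
      by (rule resolvent_reduction) (use r \<pi>(1) in \<open>auto simp: Ep_def Ez_def\<close>)
    also have "\<dots> = q + mml_transform \<alpha> \<pi>w Tw u"
      using carrier_matD[OF Twc] by (simp add: mml_transform_def)
    finally show ?thesis .
  qed

  obtain c B C where C: "C > 0" and c: "\<forall>k. \<bar>c k\<bar> \<le> B * C ^ k"
    and exp: "\<forall>u. u powr \<alpha> > C \<longrightarrow> mml_transform \<alpha> \<pi>w Tw u = (\<Sum>k. c k * inverse (u powr \<alpha>) ^ Suc k)"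
    using mml_transform_expansion[OF Twc TwM \<pi>wc] by blast
  note decomposition = atom_and_ac_from_laplace_expansion[OF alpha(1) law.finite_measure_axioms law_sets law_neg q0 C c]
  have atom: "emeasure law {0} = ennreal q"
    by (rule decomposition(1)) (simp add: transform exp)
  have null: "emeasure law A = 0" if "A \<in> null_sets lborel" "0 \<notin> A" for A
    by (rule decomposition(2)[of A]) (use that in \<open>auto simp: transform exp\<close>)

  \<comment> \<open>Once the atom is known, the absolutely continuous part can only be the restriction of the law to the
    positive half-line.\<close>
  define \<nu> where "\<nu> = density law (indicator {0<..})"
  have \<nu>: "emeasure \<nu> A = emeasure law (A \<inter> {0<..})" if "A \<in> sets borel" for A
    unfolding \<nu>_def using that by (subst emeasure_density) (auto simp: nn_integral_indicator[symmetric] law_sets indicator_inter_arith[symmetric] mult.commute simp del: nn_integral_indicator intro!: nn_integral_cong)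
  have \<nu>_sets [measurable_cong]: "sets \<nu> = sets borel" by (simp add: \<nu>_def law_sets)
  have law_space: "space law = UNIV" by (simp add: law)
  have \<nu>_transform: "(LINT x|\<nu>. exp (- (u * x))) = mml_transform \<alpha> \<pi>w Tw u" if u: "0 \<le> u" for u
  proof -
    have int: "integrable law (\<lambda>x. exp (- (u * x)))"
      by (rule law.integrable_const_bound[where B = 1]) (use law_AE u in auto)
    have "(LINT x|\<nu>. exp (- (u * x))) = (LINT x|law. indicator {0<..} x * exp (- (u * x)))"
      unfolding \<nu>_def by (subst integral_density[where g = "indicator {0<..}", unfolded ennreal_indicator]) auto
    also have "\<dots> = (LINT x|law. exp (- (u * x)) - indicator {0} x)"
      using law_AE by (intro integral_cong_AE) (auto simp: indicator_def elim!: eventually_mono)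
    also have "\<dots> = (LINT x|law. exp (- (u * x))) - measure law {0}"
      using int law_space law_sets atom by (subst Bochner_Integration.integral_diff) (auto simp: integrable_indicator_iff)
    also have "measure law {0} = q" using atom q0 by (simp add: measure_def)
    finally show ?thesis using transform[OF u] by simp
  qed
  have "defective_MML \<alpha> \<pi>w Tw \<nu>"
    unfolding defective_MML_def defective_phase_type_rep_def
  proof (intro conjI allI impI)
    show "emeasure \<nu> UNIV \<le> 1" by (simp add: \<nu> law.measure_le_1)
    have "{..<0} \<inter> {0<..} = ({} :: real set)" by auto
    then show "emeasure \<nu> {..<0} = 0" by (simp add: \<nu>)
    show "(\<Sum>i<dim_vec \<pi>w. \<pi>w $ i) \<le> 1" using \<pi>w1 q0 \<pi>wc by simp
  qed (use alpha \<pi>wc \<pi>w0 Tw_sub \<nu>_sets \<nu>_transform in auto)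
  moreover have "emeasure \<nu> {..0} = 0"
  proof -
    have "{..0} \<inter> {0<..} = ({} :: real set)" by auto
    then show ?thesis by (simp add: \<nu>)
  qed
  moreover have "absolutely_continuous lborel \<nu>"
    unfolding absolutely_continuous_def
  proof
    fix A :: "real set" assume A: "A \<in> null_sets lborel"
    then have "A \<inter> {0<..} \<in> null_sets lborel" by (intro null_set_Int2) auto
    then have "emeasure law (A \<inter> {0<..}) = 0" by (intro null) auto
    then show "A \<in> null_sets \<nu>" using A \<nu>_sets by (auto simp: null_sets_def \<nu>)
  qed
  moreover have "emeasure law A = ennreal q * emeasure (return borel 0) A + emeasure \<nu> A" if A: "A \<in> sets borel" for A
  proof -
    have "emeasure law A = emeasure law (A \<inter> {..<0}) + emeasure law (A \<inter> {0}) + emeasure law (A \<inter> {0<..})"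
    proof -
      have "A = (A \<inter> {..<0}) \<union> (A \<inter> {0}) \<union> (A \<inter> {0<..})" by auto
      moreover have "emeasure law \<dots> = emeasure law ((A \<inter> {..<0}) \<union> (A \<inter> {0})) + emeasure law (A \<inter> {0<..})"
        using A by (intro plus_emeasure[symmetric]) (auto simp: law_sets)
      moreover have "emeasure law ((A \<inter> {..<0}) \<union> (A \<inter> {0})) = emeasure law (A \<inter> {..<0}) + emeasure law (A \<inter> {0})"
        using A by (intro plus_emeasure[symmetric]) (auto simp: law_sets)
      ultimately show ?thesis by simp
    qed
    also have "emeasure law (A \<inter> {..<0}) = 0"
      using emeasure_mono[of "A \<inter> {..<0}" "{..<0}" law] law_neg by (simp add: law_sets)
    also have "emeasure law (A \<inter> {0}) = ennreal q * emeasure (return borel 0) A"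
      using A atom by (cases "0 \<in> A") (auto simp: indicator_def)
    finally show ?thesis using A by (simp add: \<nu>)
  qed
  moreover have "measure law {0} = q" using atom q0 by (simp add: measure_def)
  ultimately show ?thesis by blast
qed

end
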